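(* For every nonnegative integer $n$ there exist nonnegative integers $x,y,z,w$ such that $$n=p_5(x)+p_5(y)+p_5(z)+2p_5(w).$$ Equivalently, every nonnegative integer is a sum of five pentagonal numbers two of which are equal.
   Context: For $k\in\mathbb{Z}$, $p_5(k)=k(3k-1)/2$. The pentagonal numbers are the values $p_5(k)$ with $k\in\{0,1,2,\ldots\}$. *)

theory Defs
  imports Main
begin

definition p5 :: "int \<Rightarrow> int" where
  "p5 k = k * (3 * k - 1) div 2"

end

theory Submission
  imports
    Defs
    "HOL-Analysis.Analysis"
    "HOL-Number_Theory.Number_Theory"
    "HOL-Library.Discrete_Functions"
    "HOL-Computational_Algebra.Squarefree"
begin

text \<open>
  Following Cauchy, put \<open>a = x\<^sup>2 + y\<^sup>2 + z\<^sup>2 + 2w\<^sup>2\<close> and \<open>b = x + y + z + 2w\<close>, so that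
  \<open>2n = 3a - b\<close>. If \<open>b\<close> lies roughly between \<open>(4a)\<^sup>1\<^sup>/\<^sup>2\<close> and \<open>(5a)\<^sup>1\<^sup>/\<^sup>2\<close>, then \<open>x, y, z, w\<close> are
  automatically nonnegative, and with \<open>u = x - w\<close>, \<open>v = y - w\<close>, \<open>t = z - w\<close> one needs
  \<open>5a - b\<^sup>2 = 2 g(u, v, t)\<close> for \<open>g = 2(u\<^sup>2 + v\<^sup>2 + t\<^sup>2) - (uv + ut + vt)\<close>. The form \<open>g\<close> is Euclidean
  enough for the Davenport--Cassels descent, so a rational representation suffices, and
  over the rationals \<open>2g\<close> is equivalent to \<open>X\<^sup>2 + 5Y\<^sup>2 + 10Z\<^sup>2\<close>. For \<open>N \<equiv> \<plusminus>1 (mod 5)\<close> with squarefree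
  part \<open>D\<close>, choose a prime \<open>r \<equiv> 3 (mod 8)\<close> such that \<open>-5r\<close> is a square modulo \<open>D\<close>; by quadratic
  reciprocity \<open>(p/r) = (p/5)\<close> for every prime \<open>p\<close> dividing \<open>D\<close>, hence \<open>D\<close> is a square modulo \<open>5r\<close>.
  Then \<open>X\<^sup>2 + 5r W\<^sup>2 = D T\<^sup>2\<close> and \<open>c\<^sup>2 + 2d\<^sup>2 = r S\<^sup>2\<close> are solvable. The prime \<open>r\<close> is prescribed only
  through real characters, so it is provided by Dirichlet's argument for real characters alone.
\<close>

section \<open>Rearrangement of divisor sums and summation by parts\<close>

text \<open>Both sides run over the pairs with \<open>d * k\<close> at most \<open>N\<close>,
  matched by \<open>j = d * k\<close>. The exchange serves \<open>ln (fact N)\<close>, a truncated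
  Lambert series and the convolution with \<open>mangoldt\<close>.\<close>

lemma sum_divisors_swap:
  fixes h :: "nat \<Rightarrow> nat \<Rightarrow> 'a :: comm_monoid_add"
  shows "(\<Sum>j=1..N. \<Sum>d | d dvd j. h d (j div d)) = (\<Sum>d=1..N. \<Sum>k=1..N div d. h d k)"
proof -
  have "(\<Sum>j=1..N. \<Sum>d | d dvd j. h d (j div d))
        = (\<Sum>(j,d)\<in>(SIGMA j:{1..N}. {d. d dvd j}). h d (j div d))"
    by (rule sum.Sigma) auto
  also have "\<dots> = (\<Sum>(d,k)\<in>(SIGMA d:{1..N}. {1..N div d}). h d k)"
  proof (rule sum.reindex_bij_witness[where i = "\<lambda>(d,k). (d * k, d)" and j = "\<lambda>(j,d). (d, j div d)"])
    fix x assume "x \<in> (SIGMA j:{1..N}. {d. d dvd j})"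
    then obtain j d where x: "x = (j, d)" "1 \<le> j" "j \<le> N" "d dvd j" by auto
    then obtain k where k: "j = d * k" by (auto elim: dvdE)
    then have "d > 0" "k > 0" using x by (auto intro: Nat.gr0I)
    then show "(case case x of (j, d) \<Rightarrow> (d, j div d) of (d, k) \<Rightarrow> (d * k, d)) = x"
      and "(case x of (j, d) \<Rightarrow> (d, j div d)) \<in> (SIGMA d:{1..N}. {1..N div d})"
      and "(case case x of (j, d) \<Rightarrow> (d, j div d) of (d, k) \<Rightarrow> h d k) = (case x of (j, d) \<Rightarrow> h d (j div d))"
      using x k by (auto simp: less_eq_div_iff_mult_less_eq Suc_le_eq algebra_simps
          intro: order_trans[rotated])
  next
    fix x assume "x \<in> (SIGMA d:{1..N}. {1..N div d})"
    then obtain d k where x: "x = (d, k)" "1 \<le> d" "d \<le> N" "1 \<le> k" "k \<le> N div d" by auto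
    then have "d * k \<le> N" by (simp add: less_eq_div_iff_mult_less_eq mult.commute)
    then show "(case case x of (d, k) \<Rightarrow> (d * k, d) of (j, d) \<Rightarrow> (d, j div d)) = x"
      and "(case x of (d, k) \<Rightarrow> (d * k, d)) \<in> (SIGMA j:{1..N}. {d. d dvd j})"
      using x by auto
  qed
  also have "\<dots> = (\<Sum>d=1..N. \<Sum>k=1..N div d. h d k)"
    by (rule sum.Sigma[symmetric]) auto
  finally show ?thesis .
qed

text \<open>Dirichlet's test with an explicit constant: after summation by parts the partial sums
  carry the nonnegative weights \<open>f k - f (Suc k)\<close>, which telescope to
  \<open>f 0 - f n\<close>.\<close>

lemma abel_summation_bound:
  fixes a f :: "nat \<Rightarrow> real"
  assumes B: "\<And>n. \<bar>\<Sum>k<n. a k\<bar> \<le> B"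
    and dec: "\<And>k. f (Suc k) \<le> f k" and nonneg: "\<And>k. f k \<ge> 0"
  shows "\<bar>\<Sum>k<n. a k * f k\<bar> \<le> B * f 0"
proof -
  let ?A = "\<lambda>n. \<Sum>k<n. a k"
  have eq: "(\<Sum>k<n. a k * f k) = ?A n * f n + (\<Sum>k<n. ?A (Suc k) * (f k - f (Suc k)))" for n
    by (induction n) (simp_all add: algebra_simps)
  have tel: "(\<Sum>k<n. f k - f (Suc k)) = f 0 - f n" for n
    by (induction n) simp_all
  have "\<bar>?A n * f n\<bar> \<le> B * f n"
    using B[of n] nonneg[of n] by (simp add: abs_mult mult_right_mono)
  moreover have "\<bar>\<Sum>k<n. ?A (Suc k) * (f k - f (Suc k))\<bar> \<le> (\<Sum>k<n. B * (f k - f (Suc k)))"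
  proof (rule order_trans[OF sum_abs sum_mono])
    fix k
    have "\<bar>?A (Suc k) * (f k - f (Suc k))\<bar> = \<bar>?A (Suc k)\<bar> * (f k - f (Suc k))"
      using dec[of k] by (simp add: abs_mult)
    also have "\<dots> \<le> B * (f k - f (Suc k))"
      using B[of "Suc k"] dec[of k] by (intro mult_right_mono) auto
    finally show "\<bar>?A (Suc k) * (f k - f (Suc k))\<bar> \<le> B * (f k - f (Suc k))" .
  qed
  moreover have "(\<Sum>k<n. B * (f k - f (Suc k))) = B * f 0 - B * f n"
    unfolding sum_distrib_left[symmetric] tel by (simp add: right_diff_distrib)
  ultimately show ?thesis
    unfolding eq by linarith
qed

section \<open>Chebyshev and Mertens bounds\<close>

lemma ln_fact_eq_sum_mangoldt:
  "ln (fact N) = (\<Sum>d=1..N. mangoldt d * real (N div d))"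
proof -
  have "ln (fact N :: real) = (\<Sum>j=1..N. ln (real j))"
    by (subst ln_prod[symmetric]) (auto simp: fact_prod)
  also have "\<dots> = (\<Sum>j=1..N. \<Sum>d | d dvd j. mangoldt d)"
    by (intro sum.cong) (auto simp: mangoldt_sum)
  also have "\<dots> = (\<Sum>d=1..N. mangoldt d * real (N div d))"
    using sum_divisors_swap[of "\<lambda>d k. mangoldt d :: real" N] by (simp add: mult.commute)
  finally show ?thesis .
qed

text \<open>Chebyshev's argument: in the logarithm of the central binomial coefficient
  \<open>mangoldt d\<close> has weight \<open>2*N div d - 2 * (N div d)\<close>, never negative and
  at least 1 for \<open>d\<close> from \<open>N + 1\<close> to \<open>2*N\<close>, while the
  coefficient is at most \<open>2 ^ (2*N)\<close>.\<close>

lemma sum_mangoldt_double_le: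
  "(\<Sum>d=1..2*N. mangoldt d) \<le> (\<Sum>d=1..N. mangoldt d) + 2 * real N"
proof -
  have ext: "(\<Sum>d=1..N. mangoldt d * real (N div d)) = (\<Sum>d=1..2*N. mangoldt d * real (N div d))"
    by (rule sum.mono_neutral_left) auto
  have "real ((2*N) choose N) = fact (2*N) / (fact N * fact N)"
    by (subst binomial_fact) auto
  then have "ln (real ((2*N) choose N)) = ln (fact (2*N)) - 2 * ln (fact N)"
    by (simp add: ln_div ln_mult)
  also have "\<dots> = (\<Sum>d=1..2*N. mangoldt d * (real (2*N div d) - 2 * real (N div d)))"
    unfolding ln_fact_eq_sum_mangoldt ext
    by (simp add: sum_subtractf sum_distrib_left algebra_simps)
  also have "\<dots> \<ge> (\<Sum>d=1..2*N. if N < d then mangoldt d else 0)"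
  proof (rule sum_mono)
    fix d assume d: "d \<in> {1..2*N}"
    have "2 * (N div d) \<le> 2 * N div d"
      using d by (simp add: less_eq_div_iff_mult_less_eq)
    then have *: "2 * real (N div d) \<le> real (2 * N div d)"
      by (metis of_nat_le_iff of_nat_mult of_nat_numeral)
    moreover have "2 * N div d \<ge> 1" if "N < d" using d that
      by (simp add: Suc_le_eq div_greater_zero_iff)
    ultimately show "(if N < d then mangoldt d else 0)
        \<le> mangoldt d * (real (2*N div d) - 2 * real (N div d))"
      using mult_left_mono[of 1 "real (2 * N div d)" "mangoldt d"] mangoldt_nonneg[of d]
      by (auto intro!: mult_nonneg_nonneg)
  qed
  finally have 1: "(\<Sum>d=1..2*N. if N < d then mangoldt d else 0) \<le> ln (real ((2*N) choose N))" .
  have "(\<Sum>d=1..2*N. mangoldt d) = (\<Sum>d=1..2*N. (if d \<le> N then mangoldt d else 0) + (if N < d then mangoldt d else 0 :: real))"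
    by (intro sum.cong) auto
  also have "\<dots> = (\<Sum>d=1..2*N. if d \<le> N then mangoldt d else 0) + (\<Sum>d=1..2*N. if N < d then mangoldt d else 0)"
    by (rule sum.distrib)
  also have "(\<Sum>d=1..2*N. if d \<le> N then mangoldt d else 0 :: real) = (\<Sum>d=1..N. mangoldt d)"
    by (rule sum.mono_neutral_cong_right) auto
  finally have 2: "(\<Sum>d=1..2*N. mangoldt d) = (\<Sum>d=1..N. mangoldt d) + (\<Sum>d=1..2*N. if N < d then mangoldt d else 0 :: real)" .
  have "real ((2*N) choose N) \<le> 2 ^ (2*N)"
    using binomial_le_pow2[of "2*N" N] by (metis of_nat_le_iff of_nat_numeral of_nat_power)
  then have "ln (real ((2*N) choose N)) \<le> ln (2 ^ (2*N))"
    by (subst ln_le_cancel_iff) auto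
  also have "\<dots> = 2 * real N * ln 2" by (simp add: ln_realpow)
  also have "\<dots> \<le> 2 * real N * 1"
    using ln_le_minus_one[of 2] by (intro mult_left_mono) auto
  finally show ?thesis using 1 2 by simp
qed

text \<open>Strong induction by halving. Doubling \<open>K\<close> adds \<open>2 * K\<close>, and an
  odd \<open>N\<close> adds one further term of at most \<open>ln N\<close>, hence again at most
  \<open>2 * K\<close>; the bound \<open>4 * K\<close> for the half leaves room for both.\<close>

lemma sum_mangoldt_le: "(\<Sum>d=1..N. mangoldt d) \<le> 4 * real N"
proof (induction N rule: less_induct)
  case (less N)
  consider "N = 0" | K where "N = 2 * K" "K > 0" | K where "N = 2 * K + 1"
    by (metis oddE evenE mult_0_right not_gr_zero)
  then show ?case
  proof cases
    case 2
    then show ?thesis using sum_mangoldt_double_le[of K] less[of K] by simp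
  next
    case (3 K)
    have "(mangoldt N :: real) \<le> ln (real N)" using 3 by (intro mangoldt_le) auto
    also have "\<dots> \<le> 2 * real K" using ln_le_minus_one[of "real N"] 3 by simp
    finally have "mangoldt (Suc (2*K)) \<le> 2 * real K" using 3 by simp
    then show ?thesis using sum_mangoldt_double_le[of K] less[of K] 3 by simp
  qed auto
qed

text \<open>One half of Mertens' first theorem. The exponential series at \<open>N\<close> is at
  least its term \<open>N ^ N / fact N\<close>, which bounds \<open>ln (fact N)\<close> from below;
  replacing \<open>N div d\<close> by \<open>N / d\<close> bounds it from above.\<close>

lemma sum_mangoldt_over_ge: "(\<Sum>d=1..N. mangoldt d / real d) \<ge> ln (real N) - 1"
proof (cases "N = 0")
  case False
  have "ln (fact N) \<ge> real N * ln (real N) - real N"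
  proof -
    have "real N ^ N / fact N \<le> exp (real N)"
    proof -
      have "(\<Sum>n\<in>{N}. real N ^ n /\<^sub>R fact n) \<le> (\<Sum>n. real N ^ n /\<^sub>R fact n)"
        by (intro sum_le_suminf summable_exp_generic) auto
      then show ?thesis by (simp add: exp_def divide_inverse mult.commute)
    qed
    then have "ln (real N ^ N / fact N) \<le> ln (exp (real N))"
      using False by (subst ln_le_cancel_iff) auto
    then show ?thesis using False by (simp add: ln_div ln_realpow)
  qed
  also have "ln (fact N) = (\<Sum>d=1..N. mangoldt d * real (N div d))"
    by (rule ln_fact_eq_sum_mangoldt)
  also have "\<dots> \<le> (\<Sum>d=1..N. mangoldt d * (real N / real d))"
    by (intro sum_mono mult_left_mono mangoldt_nonneg) (simp add: of_nat_div_le_of_nat)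
  also have "\<dots> = real N * (\<Sum>d=1..N. mangoldt d / real d)"
    by (simp add: sum_distrib_left mult.commute)
  finally have "real N * (ln (real N) - 1) \<le> real N * (\<Sum>d=1..N. mangoldt d / real d)"
    by (simp add: algebra_simps)
  then show ?thesis using False by simp
qed auto

section \<open>Real characters\<close>

locale real_character =
  fixes m :: nat and \<psi> :: "nat \<Rightarrow> real"
  assumes modulus_pos: "m > 0"
    and mult: "\<And>a b. \<psi> (a * b) = \<psi> a * \<psi> b"
    and periodic: "\<And>a. \<psi> (a + m) = \<psi> a"
    and cases: "\<And>a. \<psi> a = -1 \<or> \<psi> a = 0 \<or> \<psi> a = 1"
    and nonzero_iff: "\<And>a. \<psi> a \<noteq> 0 \<longleftrightarrow> coprime a m"
begin

lemma one [simp]: "\<psi> (Suc 0) = 1"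
  using mult[of 1 1] nonzero_iff[of 1] by auto

lemma abs_le_1: "\<bar>\<psi> a\<bar> \<le> 1"
  using cases[of a] by auto

lemma periodic_mult: "\<psi> (a + k * m) = \<psi> a"
  by (induction k) (simp_all add: periodic add.assoc[symmetric] add.commute[of m])

lemma mod_modulus: "\<psi> (a mod m) = \<psi> a"
  using periodic_mult[of "a mod m" "a div m"] by simp

lemma power: "\<psi> (a ^ k) = \<psi> a ^ k"
  by (induction k) (simp_all add: mult)

text \<open>The coefficients of the Dirichlet series \<open>\<zeta>(s) L(s, \<psi>)\<close>.\<close>

definition divsum :: "nat \<Rightarrow> real" where
  "divsum n = (\<Sum>d | d dvd n. \<psi> d)"

text \<open>A divisor of \<open>a * b\<close> splits uniquely into a divisor of \<open>a\<close> and
  a divisor of \<open>b\<close>, recovered by the two gcds.\<close>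

lemma divsum_mult_coprime:
  assumes "coprime a b" "a > 0" "b > 0"
  shows "divsum (a * b) = divsum a * divsum b"
proof -
  have gcds: "gcd (d * e) a = d" "gcd (d * e) b = e" if "d dvd a" "e dvd b" for d e
  proof -
    have "coprime e a" "coprime d b"
      using coprime_divisors[OF that(2) dvd_refl, of a] coprime_divisors[OF that(1) dvd_refl, of b] assms
      by (simp_all add: coprime_commute)
    then show "gcd (d * e) a = d" "gcd (d * e) b = e"
      using that by (simp_all add: gcd_mult_left_right_cancel gcd_mult_left_left_cancel coprime_commute)
  qed
  have "divsum a * divsum b = (\<Sum>(d,e)\<in>{d. d dvd a} \<times> {e. e dvd b}. \<psi> (d * e))"
    unfolding divsum_def by (simp add: sum_product sum.cartesian_product mult)
  also have "\<dots> = divsum (a * b)"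
    unfolding divsum_def
  proof (rule sum.reindex_bij_witness[where i = "\<lambda>x. (gcd x a, gcd x b)" and j = "\<lambda>(d,e). d * e"])
    fix x assume "x \<in> {d. d dvd a} \<times> {e. e dvd b}"
    then show "(gcd (case x of (d, e) \<Rightarrow> d * e) a, gcd (case x of (d, e) \<Rightarrow> d * e) b) = x"
      using gcds by auto
  next
    fix x assume "x \<in> {d. d dvd a * b}"
    then obtain d e where "x = d * e" "d dvd a" "e dvd b" by (auto elim: dvd_productE)
    then show "(case (gcd x a, gcd x b) of (d, e) \<Rightarrow> d * e) = x"
      using gcds by simp
  qed (auto intro: mult_dvd_mono)
  finally show ?thesis by simp
qed

lemma divsum_prime_power:
  assumes "prime p"
  shows "divsum (p ^ k) = (\<Sum>i\<le>k. \<psi> p ^ i)"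
proof -
  have "{d. d dvd p ^ k} = (\<lambda>i. p ^ i) ` {..k}"
    using divides_primepow_nat[OF assms] by auto
  moreover have "inj_on (\<lambda>i. p ^ i) {..k}"
    using prime_gt_1_nat[OF assms] by (auto simp: inj_on_def)
  ultimately show ?thesis
    by (simp add: divsum_def sum.reindex power)
qed

text \<open>The geometric sum alternates between 1 and 0 for \<open>\<psi> p = -1\<close>, is 1 for
  \<open>\<psi> p = 0\<close> because \<open>0 ^ 0 = 1\<close>, and is \<open>k + 1\<close> for
  \<open>\<psi> p = 1\<close>.\<close>

lemma divsum_prime_power_ge:
  assumes "prime p"
  shows "divsum (p ^ k) \<ge> (if even k then 1 else 0)"
proof -
  consider "\<psi> p = -1" | "\<psi> p = 0" | "\<psi> p = 1" using cases[of p] by blast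
  then show ?thesis
  proof cases
    case 1
    have "(\<Sum>i\<le>k. (-1 :: real) ^ i) = (if even k then 1 else 0)" by (induction k) auto
    then show ?thesis using 1 by (simp add: divsum_prime_power[OF assms])
  next
    case 2
    have "(\<Sum>i\<le>k. (0 :: real) ^ i) = 1" by (induction k) auto
    then show ?thesis using 2 by (simp add: divsum_prime_power[OF assms])
  qed (simp add: divsum_prime_power[OF assms])
qed

text \<open>By multiplicativity the full power of one prime factor splits off, leaving a smaller
  cofactor.\<close>

lemma divsum_nonneg: "n > 0 \<Longrightarrow> divsum n \<ge> 0"
proof (induction n rule: less_induct)
  case (less n)
  show ?case
  proof (cases "n = 1")
    case False
    then obtain p where p: "prime p" "p dvd n" using prime_factor_nat by blast
    obtain j where j: "n = p ^ multiplicity p n * j" "\<not> p dvd j"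
      using multiplicity_decompose'[of n p] p less.prems by (metis neq0_conv not_prime_unit)
    have k: "multiplicity p n > 0" using p less.prems by (simp add: prime_multiplicity_gt_zero_iff)
    have j0: "j > 0" using j less.prems by (metis mult_0_right neq0_conv)
    have "p ^ multiplicity p n > 1" using k prime_gt_1_nat[OF p(1)] one_less_power by blast
    then have "j < n" using j(1) j0 by (metis mult_less_mono1 nat_mult_1)
    moreover have "coprime (p ^ multiplicity p n) j"
      using p j(2) by (simp add: prime_imp_coprime)
    ultimately have "divsum n = divsum (p ^ multiplicity p n) * divsum j" "divsum j \<ge> 0"
      using divsum_mult_coprime[of "p ^ multiplicity p n" j] j j0 less.IH p(1)
      by (auto simp: prime_gt_0_nat)
    then show ?thesis
      using divsum_prime_power_ge[OF p(1), of "multiplicity p n"] by (auto split: if_splits)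
  qed (simp add: divsum_def)
qed

text \<open>In a square all exponents are even, so every local factor is at least 1. The squares
  supply the lower bound that contradicts a vanishing \<open>L(1, \<psi>)\<close>.\<close>

lemma divsum_square_ge_1: "n > 0 \<Longrightarrow> divsum (n\<^sup>2) \<ge> 1"
proof (induction n rule: less_induct)
  case (less n)
  show ?case
  proof (cases "n = 1")
    case False
    then obtain p where p: "prime p" "p dvd n" using prime_factor_nat by blast
    define k where "k = multiplicity p n"
    obtain j where j: "n = p ^ k * j" "\<not> p dvd j"
      unfolding k_def
      using multiplicity_decompose'[of n p] p less.prems by (metis neq0_conv not_prime_unit)
    have k: "k > 0" using p less.prems by (simp add: prime_multiplicity_gt_zero_iff k_def)
    have j0: "j > 0" using j less.prems by (metis mult_0_right neq0_conv)
    have "p ^ k > 1" using k prime_gt_1_nat[OF p(1)] one_less_power by blast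
    then have "j < n" using j(1) j0 by (metis mult_less_mono1 nat_mult_1)
    then have "divsum (j\<^sup>2) \<ge> 1" using less.IH j0 by simp
    moreover have "coprime (p ^ (2 * k)) (j\<^sup>2)"
      using p j(2) by (simp add: prime_imp_coprime)
    moreover have "n\<^sup>2 = p ^ (2 * k) * j\<^sup>2"
      using j(1) by (simp add: power_mult_distrib power_mult[symmetric] mult.commute)
    ultimately have "divsum (n\<^sup>2) = divsum (p ^ (2*k)) * divsum (j\<^sup>2)" "divsum (j\<^sup>2) \<ge> 1"
      using divsum_mult_coprime[of "p ^ (2*k)" "j\<^sup>2"] j0 p(1)
      by (auto simp: prime_gt_0_nat)
    then show ?thesis
      using divsum_prime_power_ge[OF p(1), of "2*k"] mult_mono[of 1 "divsum (p ^ (2*k))" 1 "divsum (j\<^sup>2)"]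
      by simp
  qed (simp add: divsum_def)
qed

end

section \<open>Convergence of L(1, psi) for nonprincipal real characters\<close>

locale nonprincipal_real_character = real_character +
  assumes nonprincipal: "\<exists>c. \<psi> c = -1"
begin

text \<open>Multiplication by \<open>c\<close> with \<open>\<psi> c = -1\<close> permutes the
  residues and changes the sign of the sum.\<close>

lemma sum_period: "(\<Sum>n<m. \<psi> n) = 0"
proof -
  obtain c where c: "\<psi> c = -1" using nonprincipal by blast
  then have "coprime c m" using nonzero_iff[of c] by auto
  then have "inj_on (\<lambda>n. c * n mod m) {..<m}"
    by (intro inj_onI) (metis cong_def cong_mult_lcancel_nat lessThan_iff mod_less)
  moreover have "(\<lambda>n. c * n mod m) ` {..<m} \<subseteq> {..<m}" using modulus_pos by auto
  ultimately have "bij_betw (\<lambda>n. c * n mod m) {..<m} {..<m}"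
    by (simp add: bij_betw_def endo_inj_surj)
  then have "(\<Sum>n<m. \<psi> n) = (\<Sum>n<m. \<psi> (c * n mod m))"
    by (rule sum.reindex_bij_betw[symmetric])
  also have "\<dots> = - (\<Sum>n<m. \<psi> n)"
    by (simp add: mod_modulus mult c sum_negf)
  finally show ?thesis by simp
qed

lemma abs_sum_le_modulus: "\<bar>\<Sum>k<n. \<psi> k\<bar> \<le> real m"
proof (induction n rule: less_induct)
  case (less n)
  show ?case
  proof (cases "n < m")
    case True
    have "\<bar>\<Sum>k<n. \<psi> k\<bar> \<le> (\<Sum>k<n. 1)"
      by (rule order_trans[OF sum_abs sum_mono]) (rule abs_le_1)
    then show ?thesis using True by simp
  next
    case False
    then obtain j where j: "n = m + j" by (auto simp: not_less le_iff_add)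
    have "(\<Sum>k<m + j. \<psi> k) = (\<Sum>k<j. \<psi> k)" for j
      by (induction j) (simp_all add: sum_period periodic add.commute[of m])
    then show ?thesis using less[of j] j modulus_pos by simp
  qed
qed

lemma abs_shifted_sum_le: "\<bar>\<Sum>k<n. \<psi> (k + s)\<bar> \<le> 2 * real m"
proof -
  have "(\<Sum>k<n. \<psi> (k + s)) = (\<Sum>k<n + s. \<psi> k) - (\<Sum>k<s. \<psi> k)"
    by (induction n) simp_all
  then show ?thesis using abs_sum_le_modulus[of "n + s"] abs_sum_le_modulus[of s] by linarith
qed

definition Lsum :: "nat \<Rightarrow> real" where
  "Lsum N = (\<Sum>n=1..N. \<psi> n / real n)"

text \<open>Summation by parts against the decreasing weights \<open>1/n\<close>. The explicit rate
  \<open>1/M\<close> is what later keeps the error in \<open>abs_sum_mangoldt_le\<close>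
  bounded.\<close>

lemma Lsum_tail: "\<bar>Lsum (M + j) - Lsum M\<bar> \<le> 2 * real m / real (Suc M)"
proof -
  have eq: "Lsum (M + j) - Lsum M = (\<Sum>k<j. \<psi> (k + Suc M) * (1 / real (k + Suc M)))"
    unfolding Lsum_def by (induction j) (simp_all add: add.commute)
  have "\<bar>\<Sum>k<j. \<psi> (k + Suc M) * (1 / real (k + Suc M))\<bar> \<le> 2 * real m * (1 / real (0 + Suc M))"
    by (rule abel_summation_bound) (auto intro: abs_shifted_sum_le simp: frac_le simp del: add_Suc_right)
  then show ?thesis by (simp add: eq)
qed

lemma Lsum_limit:
  obtains L where "Lsum \<longlonglongrightarrow> L" "\<And>M. \<bar>Lsum M - L\<bar> \<le> 2 * real m / real (Suc M)"
proof -
  have "Cauchy Lsum"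
    unfolding Cauchy_altdef2
  proof (intro allI impI)
    fix e :: real assume "e > 0"
    then obtain M where "2 * real m / e < real M" using reals_Archimedean2 by blast
    then have "2 * real m / real (Suc M) < e" using \<open>e > 0\<close>
      by (simp add: field_simps)
    then have "dist (Lsum n) (Lsum M) < e" if "n \<ge> M" for n
      using Lsum_tail[of M "n - M"] that by (simp add: dist_real_def)
    then show "\<exists>N. \<forall>n\<ge>N. dist (Lsum n) (Lsum N) < e" by blast
  qed
  then obtain L where L: "Lsum \<longlonglongrightarrow> L"
    using Cauchy_convergent convergent_def by blast
  have "\<bar>Lsum M - L\<bar> \<le> 2 * real m / real (Suc M)" for M
  proof -
    have "(\<lambda>j. \<bar>Lsum (M + j) - Lsum M\<bar>) \<longlonglongrightarrow> \<bar>L - Lsum M\<bar>"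
      using LIMSEQ_ignore_initial_segment[OF L, of M]
      by (intro tendsto_intros) (simp add: add.commute)
    then have "\<bar>L - Lsum M\<bar> \<le> 2 * real m / real (Suc M)"
      by (rule LIMSEQ_le_const2) (use Lsum_tail in auto)
    then show ?thesis by (simp add: abs_minus_commute)
  qed
  with L show ?thesis using that by blast
qed

end

section \<open>Non-vanishing of L(1, psi) by Monsky's method\<close>

text \<open>AM-GM for the terms of index \<open>i\<close> and \<open>n - 1 - i\<close>, whose sum is
  at least twice \<open>s ^ (n - 1)\<close>. Induction in steps of two peels off the first and last
  term; the extra factor \<open>s\<close> avoids the exponent \<open>n - 1\<close>.\<close>

lemma geometric_sum_am_gm:
  fixes s :: real
  assumes "s \<ge> 0"
  shows "real n * s ^ n \<le> s * (\<Sum>i<n. (s\<^sup>2) ^ i)"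
proof (induction n rule: induct_nat_012)
  case (ge2 n)
  have "(\<Sum>i<Suc (Suc n). (s\<^sup>2) ^ i) = 1 + s\<^sup>2 * (\<Sum>i<n. (s\<^sup>2) ^ i) + (s\<^sup>2) ^ Suc n"
    by (subst sum.lessThan_Suc, subst sum.lessThan_Suc_shift) (simp add: sum_distrib_left)
  then have "s * (\<Sum>i<Suc (Suc n). (s\<^sup>2) ^ i)
      = s * (1 + (s ^ Suc n)\<^sup>2) + s\<^sup>2 * (s * (\<Sum>i<n. (s\<^sup>2) ^ i))"
    by (simp add: power_mult[symmetric] mult.commute algebra_simps)
  moreover have "s * (1 + (s ^ Suc n)\<^sup>2) \<ge> s * (2 * s ^ Suc n)"
    using zero_le_power2[of "1 - s ^ Suc n"] assms
    by (intro mult_left_mono) (auto simp: power2_eq_square algebra_simps)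
  moreover have "s\<^sup>2 * (s * (\<Sum>i<n. (s\<^sup>2) ^ i)) \<ge> s\<^sup>2 * (real n * s ^ n)"
    using ge2(1) by (intro mult_left_mono) auto
  moreover have "real (Suc (Suc n)) * s ^ Suc (Suc n) = s * (2 * s ^ Suc n) + s\<^sup>2 * (real n * s ^ n)"
    by (simp add: algebra_simps power2_eq_square)
  ultimately show ?case by linarith
qed simp_all

text \<open>Multiply the bounds for \<open>n\<close> and \<open>Suc n\<close> at
  \<open>s = sqrt t\<close>; a factor \<open>s\<close> remains on the right and is at most
  1.\<close>

lemma geometric_sum_product_ge:
  fixes t :: real
  assumes "0 < t" "t < 1"
  shows "real n * real (Suc n) * t ^ n \<le> (\<Sum>i<n. t ^ i) * (\<Sum>i<Suc n. t ^ i)"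
proof -
  define s where "s = sqrt t"
  have s: "0 < s" "s < 1" "s\<^sup>2 = t" using assms by (auto simp: s_def)
  let ?G = "\<lambda>n. \<Sum>i<n. t ^ i"
  have nn: "?G n \<ge> 0" for n using assms by (intro sum_nonneg) auto
  have "(real n * s ^ n) * (real (Suc n) * s ^ Suc n) \<le> (s * ?G n) * (s * ?G (Suc n))"
  proof (rule mult_mono)
    show "real n * s ^ n \<le> s * ?G n" "real (Suc n) * s ^ Suc n \<le> s * ?G (Suc n)"
      using geometric_sum_am_gm[of s n] geometric_sum_am_gm[of s "Suc n"] s(1) unfolding s(3) by simp_all
    show "s * ?G n \<ge> 0" using nn s(1) by simp
    show "real (Suc n) * s ^ Suc n \<ge> 0" using s(1) by simp
  qed
  also have "(real n * s ^ n) * (real (Suc n) * s ^ Suc n) = s * (real n * real (Suc n) * t ^ n)"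
    unfolding s(3)[symmetric] by (simp add: power_mult[symmetric] mult_2 power_add)
  also have "(s * ?G n) * (s * ?G (Suc n)) = s * (s * (?G n * ?G (Suc n)))"
    by (simp add: algebra_simps)
  finally have "real n * real (Suc n) * t ^ n \<le> s * (?G n * ?G (Suc n))"
    using s(1) by simp
  also have "\<dots> \<le> 1 * (?G n * ?G (Suc n))"
    using s nn by (intro mult_right_mono mult_nonneg_nonneg) auto
  finally show ?thesis by simp
qed

text \<open>The weights \<open>1/n - t\<^sup>n (1 - t)/(1 - t\<^sup>n)\<close> in Monsky's proof that \<open>L(1, \<psi>) \<noteq> 0\<close>,
  indexed by \<open>k = n - 1\<close>.\<close>

definition monsky_weight :: "real \<Rightarrow> nat \<Rightarrow> real" where
  "monsky_weight t k = 1 / real (Suc k) - t ^ Suc k / (\<Sum>i<Suc k. t ^ i)"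

lemma geometric_sum_pos:
  fixes t :: real
  assumes "0 < t"
  shows "(\<Sum>i<Suc k. t ^ i) > 0"
  using assms by (intro sum_pos) auto

lemma monsky_weight_nonneg:
  assumes "0 < t" "t < 1"
  shows "monsky_weight t k \<ge> 0"
proof -
  have "(\<Sum>i<Suc k. t ^ Suc k) \<le> (\<Sum>i<Suc k. t ^ i)"
    using assms by (intro sum_mono power_decreasing) auto
  then have "real (Suc k) * t ^ Suc k \<le> (\<Sum>i<Suc k. t ^ i)" by simp
  then show ?thesis
    using geometric_sum_pos[OF assms(1), of k] unfolding monsky_weight_def
    by (simp add: field_simps del: sum.lessThan_Suc)
qed

text \<open>With \<open>G n\<close> the geometric sum, the weights for \<open>n\<close> and
  \<open>n + 1\<close> differ by \<open>1 / (n * (n + 1)) - t ^ n / (G n * G (n + 1))\<close>, so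
  \<open>geometric_sum_product_ge\<close> suffices.\<close>

lemma monsky_weight_decreasing:
  assumes "0 < t" "t < 1"
  shows "monsky_weight t (Suc k) \<le> monsky_weight t k"
proof -
  let ?G = "\<lambda>n. \<Sum>i<n. t ^ i"
  define n where "n = Suc k"
  define A where "A = ?G n"
  have A: "A > 0" "?G (Suc n) > 0"
    using geometric_sum_pos[OF assms(1)] by (simp_all only: A_def n_def)
  have GS: "?G (Suc n) = 1 + t * A"
    unfolding A_def by (subst sum.lessThan_Suc_shift) (simp add: sum_distrib_left)
  have "real n * real (Suc n) * t ^ n \<le> A * (1 + t * A)"
    using geometric_sum_product_ge[OF assms, of n] unfolding GS A_def[symmetric] .
  then have "real n * real (Suc n) * (t ^ n / (A * (1 + t * A))) \<le> 1"
    using A GS by simp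
  moreover have "real n * real (Suc n) > 0" by (simp add: n_def)
  ultimately have "t ^ n / (A * (1 + t * A)) \<le> 1 / (real n * real (Suc n))"
    by (metis mult.commute pos_le_divide_eq)
  moreover have "t ^ n / A - t ^ Suc n / (1 + t * A) = t ^ n / (A * (1 + t * A))"
    using A GS by (simp add: field_simps)
  moreover have "1 / real n - 1 / real (Suc n) = 1 / (real n * real (Suc n))"
    by (simp add: field_simps n_def)
  ultimately have "1 / real (Suc n) - t ^ Suc n / ?G (Suc n) \<le> 1 / real n - t ^ n / A"
    unfolding GS by linarith
  then show ?thesis unfolding monsky_weight_def n_def A_def .
qed

context nonprincipal_real_character
begin

text \<open>The left side is a truncated Lambert series times \<open>1 - t\<close>. Each scaled
  inner geometric sum is \<open>1/d\<close> minus a Monsky weight minus a truncation remainder: the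
  first parts give \<open>Lsum N\<close>, the weights are handled by Abel summation with first
  weight \<open>1 - t\<close>, and each remainder is at most \<open>t ^ N\<close>.\<close>

lemma divsum_power_series_bound:
  assumes t: "0 < t" "t < 1"
  shows "(1 - t) * (\<Sum>j=1..N. divsum j * t ^ j)
    \<le> \<bar>Lsum N\<bar> + 2 * real m * (1 - t) + real N * t ^ N"
proof -
  let ?G = "\<lambda>n. \<Sum>i<n. t ^ i"
  have G1: "?G d \<ge> 1" if "d \<ge> 1" for d
  proof -
    have "(\<Sum>i\<in>{0}. t ^ i) \<le> ?G d" using that t by (intro sum_mono2) auto
    then show ?thesis by simp
  qed
  have "(\<Sum>j=1..N. divsum j * t ^ j) = (\<Sum>j=1..N. \<Sum>d | d dvd j. \<psi> d * t ^ (d * (j div d)))"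
    unfolding divsum_def sum_distrib_right by (intro sum.cong) auto
  also have "\<dots> = (\<Sum>d=1..N. \<Sum>k=1..N div d. \<psi> d * t ^ (d * k))"
    by (rule sum_divisors_swap)
  finally have "(1 - t) * (\<Sum>j=1..N. divsum j * t ^ j)
      = (\<Sum>d=1..N. \<psi> d * ((1 - t) * (\<Sum>k=1..N div d. t ^ (d * k))))"
    by (simp add: sum_distrib_left algebra_simps)
  also have "\<dots> = (\<Sum>d=1..N. \<psi> d / real d - \<psi> d * monsky_weight t (d - 1)
                           - \<psi> d * (t ^ (d * Suc (N div d)) / ?G d))"
  proof (rule sum.cong)
    fix d assume d: "d \<in> {1..N}"
    define K where "K = N div d"
    have y: "t ^ d < 1" using d t by (simp add: power_less_one_iff)
    have "(1 - t ^ d) * (\<Sum>k=1..K. t ^ (d * k)) = t ^ d - t ^ (d * Suc K)" for K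
    proof (induction K)
      case (Suc K)
      have "(1 - t ^ d) * (\<Sum>k=1..Suc K. t ^ (d * k))
          = (1 - t ^ d) * (\<Sum>k=1..K. t ^ (d * k)) + (1 - t ^ d) * t ^ (d * Suc K)"
        by (simp add: distrib_left)
      also have "\<dots> = t ^ d - t ^ d * t ^ (d * Suc K)"
        unfolding Suc.IH by (simp add: algebra_simps)
      finally show ?case by (simp add: power_add)
    qed simp
    moreover have "(1 - t) * ?G d = 1 - t ^ d"
      by (simp add: one_diff_power_eq)
    ultimately have "?G d * ((1 - t) * (\<Sum>k=1..K. t ^ (d * k))) = t ^ d - t ^ (d * Suc K)"
      by (metis mult.assoc mult.commute)
    then have E1: "(1 - t) * (\<Sum>k=1..K. t ^ (d * k)) = t ^ d / ?G d - t ^ (d * Suc K) / ?G d"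
      using G1[of d] d by (simp add: field_simps)
    have E2: "t ^ d / ?G d = 1 / real d - monsky_weight t (d - 1)"
      using d by (simp add: monsky_weight_def)
    show "\<psi> d * ((1 - t) * (\<Sum>k=1..N div d. t ^ (d * k))) =
        \<psi> d / real d - \<psi> d * monsky_weight t (d - 1) - \<psi> d * (t ^ (d * Suc (N div d)) / ?G d)"
      unfolding K_def[symmetric] E1 E2 by (simp add: right_diff_distrib)
  qed simp
  also have "\<dots> = Lsum N - (\<Sum>d=1..N. \<psi> d * monsky_weight t (d - 1))
                      - (\<Sum>d=1..N. \<psi> d * (t ^ (d * Suc (N div d)) / ?G d))"
    by (simp add: Lsum_def sum_subtractf)
  finally have eq: "(1 - t) * (\<Sum>j=1..N. divsum j * t ^ j) = \<dots>" .
  have "(\<Sum>d=1..N. \<psi> d * monsky_weight t (d - 1)) = (\<Sum>k<N. \<psi> (k + 1) * monsky_weight t k)"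
    by (rule sum.reindex_bij_witness[where i = "\<lambda>k. k + 1" and j = "\<lambda>d. d - 1"]) auto
  moreover have "\<bar>\<Sum>k<N. \<psi> (k + 1) * monsky_weight t k\<bar> \<le> 2 * real m * monsky_weight t 0"
    using t by (intro abel_summation_bound abs_shifted_sum_le monsky_weight_decreasing monsky_weight_nonneg)
  moreover have "monsky_weight t 0 = 1 - t" by (simp add: monsky_weight_def)
  moreover have "\<bar>\<Sum>d=1..N. \<psi> d * (t ^ (d * Suc (N div d)) / ?G d)\<bar> \<le> (\<Sum>d=1..N. t ^ N)"
  proof (rule order_trans[OF sum_abs sum_mono])
    fix d assume d: "d \<in> {1..N}"
    \<comment> \<open>This exponent is the first multiple of \<open>d\<close> beyond
      \<open>N\<close>.\<close>
    have "N \<le> d * Suc (N div d)"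
      using d dividend_less_times_div[of d N] by simp
    then have "t ^ (d * Suc (N div d)) \<le> t ^ N" using t by (intro power_decreasing) auto
    moreover have "t ^ (d * Suc (N div d)) / ?G d \<le> t ^ (d * Suc (N div d)) / 1"
      using G1[of d] d t by (intro divide_left_mono) auto
    moreover have "t ^ (d * Suc (N div d)) / ?G d \<ge> 0"
      using G1[of d] d t by (intro divide_nonneg_nonneg) auto
    moreover have "\<bar>\<psi> d * (t ^ (d * Suc (N div d)) / ?G d)\<bar> \<le> 1 * \<bar>t ^ (d * Suc (N div d)) / ?G d\<bar>"
      unfolding abs_mult by (intro mult_right_mono abs_le_1) auto
    ultimately show "\<bar>\<psi> d * (t ^ (d * Suc (N div d)) / ?G d)\<bar> \<le> t ^ N" by linarith
  qed
  ultimately show ?thesis unfolding eq by (simp add: mult.commute)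
qed

text \<open>If the limit were 0, letting \<open>N\<close> tend to infinity and dividing by
  \<open>1 - t\<close> would bound the sum of \<open>t ^ (j\<^sup>2)\<close> by \<open>2 * m\<close>
  for all \<open>t\<close> below 1; letting \<open>t\<close> tend to 1 contradicts this for
  \<open>2 * m + 1\<close> squares.\<close>

lemma Lsum_not_tendsto_0: "\<not> Lsum \<longlonglongrightarrow> 0"
proof
  assume L: "Lsum \<longlonglongrightarrow> 0"
  define J where "J = 2 * m + 1"
  have bound: "(\<Sum>j=1..J. t ^ (j\<^sup>2)) \<le> 2 * real m" if t: "0 < t" "t < 1" for t :: real
  proof -
    have "(\<lambda>N. \<bar>Lsum N\<bar> + 2 * real m * (1 - t) + real N * t ^ N)
        \<longlonglongrightarrow> \<bar>0\<bar> + 2 * real m * (1 - t) + 0"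
      using t by (intro tendsto_intros L powser_times_n_limit_0) auto
    moreover have "(1 - t) * (\<Sum>j=1..J. t ^ (j\<^sup>2)) \<le> \<bar>Lsum N\<bar> + 2 * real m * (1 - t) + real N * t ^ N"
      if "N \<ge> J\<^sup>2" for N
    proof -
      \<comment> \<open>Only squares are kept: \<open>divsum\<close> is at least 1 there and
        nonnegative elsewhere.\<close>
      have "(\<Sum>j=1..J. t ^ (j\<^sup>2)) \<le> (\<Sum>j=1..J. divsum (j\<^sup>2) * t ^ (j\<^sup>2))"
        using divsum_square_ge_1 t by (intro sum_mono) auto
      also have "\<dots> = (\<Sum>j\<in>power2 ` {1..J}. divsum j * t ^ j)"
        by (subst sum.reindex) (auto simp: inj_on_def)
      also have "\<dots> \<le> (\<Sum>j=1..N. divsum j * t ^ j)"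
      proof (rule sum_mono2)
        show "power2 ` {1..J} \<subseteq> {1..N}"
          using that by (auto intro: order_trans[OF power_mono[of _ J 2]])
      qed (use t in \<open>auto intro!: mult_nonneg_nonneg divsum_nonneg\<close>)
      finally have "(1 - t) * (\<Sum>j=1..J. t ^ (j\<^sup>2)) \<le> (1 - t) * (\<Sum>j=1..N. divsum j * t ^ j)"
        using t by (intro mult_left_mono) auto
      then show ?thesis using divsum_power_series_bound[OF t, of N] by linarith
    qed
    ultimately have "(1 - t) * (\<Sum>j=1..J. t ^ (j\<^sup>2)) \<le> 2 * real m * (1 - t)"
      by (intro LIMSEQ_le_const[where x = "2 * real m * (1 - t)"]) auto
    then show ?thesis using t by (simp add: mult.commute[of "1 - t"])
  qed
  \<comment> \<open>The points \<open>1 - 1/(i + 2)\<close> start at 1/2 and tend to 1, so all of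
    them lie strictly between 0 and 1.\<close>
  have "(\<lambda>i. \<Sum>j=1..J. (1 - inverse (real (Suc (Suc i)))) ^ (j\<^sup>2)) \<longlonglongrightarrow> (\<Sum>j=1..J. (1 - 0) ^ (j\<^sup>2))"
    by (intro tendsto_intros LIMSEQ_Suc[OF LIMSEQ_inverse_real_of_nat])
  then have "(\<Sum>j=1..J. (1 - 0) ^ (j\<^sup>2)) \<le> 2 * real m"
  proof (rule LIMSEQ_le_const2, intro exI[of _ 0] allI impI)
    fix i :: nat
    show "(\<Sum>j=1..J. (1 - inverse (real (Suc (Suc i)))) ^ (j\<^sup>2)) \<le> 2 * real m"
      by (rule bound) (auto simp: field_simps)
  qed
  then show False by (simp add: J_def)
qed

text \<open>\<open>ln x / x\<close> decreases only from \<open>x = e\<close> on, so summation by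
  parts starts at \<open>n = 3\<close>, whence the shift in \<open>f\<close>; the terms 1 and 2 are
  treated separately.\<close>

lemma abs_sum_ln_le: "\<exists>C. \<forall>N. \<bar>\<Sum>n=1..N. \<psi> n * ln (real n) / real n\<bar> \<le> C"
proof -
  define f where "f = (\<lambda>k. ln (real (k + 3)) / real (k + 3))"
  have dec: "f (Suc k) \<le> f k" for k
  proof -
    define x where "x = real (k + 3)"
    have x: "x \<ge> 3" by (simp add: x_def)
    have "ln x \<ge> ln (exp 1)" using x exp_le by (subst ln_le_cancel_iff) auto
    then have "ln x \<ge> 1" by simp
    moreover have "ln (x + 1) - ln x = ln (1 + 1 / x)"
    proof -
      have "1 + 1 / x = (x + 1) / x" using x by (simp add: field_simps)
      then show ?thesis using x by (simp add: ln_div)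
    qed
    moreover have "x * ln (1 + 1 / x) \<le> x * (1 / x)"
      using x ln_add_one_self_le_self[of "1 / x"] by (intro mult_left_mono) auto
    ultimately have "x * ln (x + 1) \<le> (x + 1) * ln x" using x by (simp add: algebra_simps)
    then have "ln (x + 1) / (x + 1) \<le> ln x / x" using x by (simp add: field_simps)
    then show ?thesis by (simp add: f_def x_def add.commute)
  qed
  have bd: "\<bar>\<Sum>k<N. \<psi> (k + 3) * f k\<bar> \<le> 2 * real m * f 0" for N
    by (rule abel_summation_bound) (auto intro: abs_shifted_sum_le dec, simp add: f_def)
  have tail: "(\<Sum>n=1..N + 2. \<psi> n * ln (real n) / real n) = \<psi> 2 * ln 2 / 2 + (\<Sum>k<N. \<psi> (k + 3) * f k)" for N
    by (induction N) (simp_all add: f_def numeral_2_eq_2 numeral_3_eq_3)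
  have small: "\<bar>\<psi> 2 * ln 2 / 2\<bar> \<le> 1"
    using cases[of 2] ln_le_minus_one[of 2] by auto
  have "\<bar>\<Sum>n=1..N. \<psi> n * ln (real n) / real n\<bar> \<le> 1 + 2 * real m * f 0" for N
  proof (cases "N \<ge> 2")
    case True
    then obtain K where K: "N = K + 2" by (metis add.commute le_iff_add)
    show ?thesis unfolding K using tail[of K] bd[of K] small by linarith
  next
    case False
    then have "N = 0 \<or> N = 1" by auto
    then show ?thesis by (auto simp: f_def)
  qed
  then show ?thesis by blast
qed

text \<open>As \<open>ln\<close> is the divisor sum of \<open>mangoldt\<close>, the bounded sum of
  \<open>\<psi> n * ln n / n\<close> equals the sum of \<open>\<psi> d * mangoldt d / d\<close>
  weighted by \<open>Lsum (N div d)\<close>. Replacing the weight by its limit \<open>L\<close>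
  costs at most \<open>2 * m / N\<close> times the Chebyshev sum, hence at most
  \<open>8 * m\<close>; then divide by \<open>L\<close>, which is nonzero.\<close>

lemma abs_sum_mangoldt_le:
  "\<exists>C. \<forall>N. \<bar>\<Sum>d=1..N. \<psi> d * mangoldt d / real d\<bar> \<le> C"
proof -
  obtain L where L: "Lsum \<longlonglongrightarrow> L" "\<And>M. \<bar>Lsum M - L\<bar> \<le> 2 * real m / real (Suc M)"
    using Lsum_limit by blast
  have "L \<noteq> 0" using L Lsum_not_tendsto_0 by blast
  obtain C where C: "\<And>N. \<bar>\<Sum>n=1..N. \<psi> n * ln (real n) / real n\<bar> \<le> C"
    using abs_sum_ln_le by blast
  have "\<bar>\<Sum>d=1..N. \<psi> d * mangoldt d / real d\<bar> \<le> (C + 8 * real m) / \<bar>L\<bar>" for N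
  proof -
    let ?g = "\<lambda>d. \<psi> d * mangoldt d / real d"
    have "(\<Sum>n=1..N. \<psi> n * ln (real n) / real n)
        = (\<Sum>n=1..N. \<Sum>d | d dvd n. ?g d * (\<psi> (n div d) / real (n div d)))"
    proof (rule sum.cong)
      fix n assume n: "n \<in> {1..N}"
      have "\<psi> n * ln (real n) / real n = (\<Sum>d | d dvd n. \<psi> n / real n * mangoldt d)"
        unfolding sum_distrib_left[symmetric] using n by (simp add: mangoldt_sum)
      also have "\<dots> = (\<Sum>d | d dvd n. ?g d * (\<psi> (n div d) / real (n div d)))"
        by (intro sum.cong) (auto simp: mult elim!: dvdE)
      finally show "\<psi> n * ln (real n) / real n = \<dots>" .
    qed simp
    also have "\<dots> = (\<Sum>d=1..N. \<Sum>k=1..N div d. ?g d * (\<psi> k / real k))"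
      by (rule sum_divisors_swap)
    also have "\<dots> = (\<Sum>d=1..N. ?g d * Lsum (N div d))"
      by (simp add: Lsum_def sum_distrib_left)
    finally have "(\<Sum>n=1..N. \<psi> n * ln (real n) / real n) - L * (\<Sum>d=1..N. ?g d)
        = (\<Sum>d=1..N. ?g d * (Lsum (N div d) - L))"
      by (simp add: sum_distrib_left sum_subtractf right_diff_distrib mult.commute[of L])
    moreover have "\<bar>\<Sum>d=1..N. ?g d * (Lsum (N div d) - L)\<bar> \<le> 8 * real m"
    proof (cases "N = 0")
      case False
      have "\<bar>\<Sum>d=1..N. ?g d * (Lsum (N div d) - L)\<bar> \<le> (\<Sum>d=1..N. 2 * real m / real N * mangoldt d)"
      proof (rule order_trans[OF sum_abs sum_mono])
        fix d assume d: "d \<in> {1..N}"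
        have "N < d * Suc (N div d)" using d dividend_less_times_div[of d N] by simp
        then have "real N < real d * real (Suc (N div d))" by (metis of_nat_less_iff of_nat_mult)
        then have "2 * real m * real N \<le> 2 * real m * (real d * real (Suc (N div d)))"
          by (intro mult_left_mono) auto
        then have "2 * real m / real (Suc (N div d)) \<le> 2 * real m * real d / real N"
          using False by (simp add: field_simps)
        then have "\<bar>Lsum (N div d) - L\<bar> \<le> 2 * real m * real d / real N"
          using L(2)[of "N div d"] by linarith
        moreover have "\<bar>?g d\<bar> \<le> mangoldt d / real d"
          using mult_right_mono[OF abs_le_1[of d], of "mangoldt d / real d"] mangoldt_nonneg[of d]
          by (simp add: abs_mult)
        ultimately have "\<bar>?g d\<bar> * \<bar>Lsum (N div d) - L\<bar> \<le> (mangoldt d / real d) * (2 * real m * real d / real N)"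
          using mangoldt_nonneg[of d] by (intro mult_mono) auto
        also have "\<dots> = 2 * real m / real N * mangoldt d" using d by simp
        finally show "\<bar>?g d * (Lsum (N div d) - L)\<bar> \<le> 2 * real m / real N * mangoldt d"
          unfolding abs_mult[of "?g d" "Lsum (N div d) - L"] .
      qed
      also have "\<dots> \<le> 2 * real m / real N * (4 * real N)"
        unfolding sum_distrib_left[symmetric] by (intro mult_left_mono sum_mangoldt_le) auto
      also have "\<dots> = 8 * real m" using False by simp
      finally show ?thesis .
    qed simp
    ultimately have "\<bar>L * (\<Sum>d=1..N. ?g d)\<bar> \<le> C + 8 * real m"
      using C[of N] by linarith
    then show ?thesis using \<open>L \<noteq> 0\<close> by (simp add: abs_mult field_simps)
  qed
  then show ?thesis by blast
qed

end

section \<open>Primes with prescribed values of all real characters\<close>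

text \<open>Only powers of the finitely many primes dividing \<open>m\<close> contribute, and for
  each of them the sum of \<open>1 / p ^ k\<close> is at most 1.\<close>

lemma sum_mangoldt_over_noncoprime_le:
  assumes "m > 0"
  shows "(\<Sum>d\<in>{d\<in>{1..N}. \<not> coprime d m}. mangoldt d / real d) \<le> (\<Sum>p\<in>prime_factors m. ln (real p))"
proof -
  let ?A = "{d\<in>{1..N}. \<not> coprime d m}"
  let ?P = "prime_factors m \<times> {1..N}"
  have geo: "(\<Sum>k=1..N. 1 / real (p ^ k)) \<le> 1" if "p \<ge> 2" for p :: nat
  proof -
    have "(\<Sum>k=1..N. 1 / real (p ^ k)) \<le> (\<Sum>k=1..N. 1 / 2 ^ k)"
      using that by (intro sum_mono frac_le) (auto intro!: power_mono)
    also have "\<dots> = 1 - 1 / 2 ^ N" by (induction N) (simp_all add: field_simps)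
    finally show ?thesis by (smt (verit) zero_le_divide_1_iff zero_le_power)
  qed
  have "(\<Sum>d\<in>?A. mangoldt d / real d) \<le> (\<Sum>d\<in>(\<lambda>(p,k). p ^ k) ` ?P. mangoldt d / real d)"
    (is "_ \<le> sum _ ?I")
  proof -
    have "mangoldt d / real d = 0" if d: "d \<in> ?A" "d \<notin> ?I" for d
    proof -
      have "\<not> primepow d"
      proof
        assume "primepow d"
        then obtain p k where pk: "prime p" "k > 0" "d = p ^ k" by (auto simp: primepow_def)
        have "p dvd m" using d(1) pk prime_imp_coprime[of p m] by auto
        \<comment> \<open>Hence the exponent stays below \<open>N\<close>, and the finite grid
          \<open>?P\<close> reaches every relevant prime power.\<close>
        moreover have "k < p ^ k" using prime_gt_1_nat[OF pk(1)] power_gt_expt[of p k] by simp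
        ultimately have "(p, k) \<in> ?P" using d(1) pk assms by (auto simp: in_prime_factors_iff)
        then have "p ^ k \<in> ?I" by (rule rev_image_eqI) simp
        then show False using d(2) pk by simp
      qed
      then show ?thesis by (simp add: mangoldt_def)
    qed
    then have "(\<Sum>d\<in>?A. mangoldt d / real d) = (\<Sum>d\<in>?A \<inter> ?I. mangoldt d / real d)"
      by (intro sum.mono_neutral_right) auto
    also have "\<dots> \<le> (\<Sum>d\<in>?I. mangoldt d / real d)"
      by (intro sum_mono2) (auto intro!: divide_nonneg_nonneg mangoldt_nonneg)
    finally show ?thesis .
  qed
  also have "\<dots> \<le> (\<Sum>(p,k)\<in>?P. mangoldt (p ^ k) / real (p ^ k))"
    using sum_image_le[of ?P "\<lambda>d. mangoldt d / real d" "\<lambda>(p,k). p ^ k"]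
    by (simp add: o_def case_prod_unfold mangoldt_nonneg)
  also have "\<dots> = (\<Sum>p\<in>prime_factors m. \<Sum>k=1..N. mangoldt (p ^ k) / real (p ^ k))"
    by (rule sum.cartesian_product[symmetric])
  also have "\<dots> = (\<Sum>p\<in>prime_factors m. ln (real p) * (\<Sum>k=1..N. 1 / real (p ^ k)))"
    unfolding sum_distrib_left
    by (intro sum.cong) (auto simp: mangoldt_primepow' dest: in_prime_factors_imp_prime)
  also have "\<dots> \<le> (\<Sum>p\<in>prime_factors m. ln (real p) * 1)"
    by (intro sum_mono mult_left_mono geo) (auto dest!: in_prime_factors_imp_prime intro!: ln_ge_zero simp: prime_ge_2_nat prime_ge_Suc_0_nat)
  finally show ?thesis by simp
qed

text \<open>At \<open>d = j\<^sup>2\<close> the numerator is at most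
  \<open>2 * ln j = 4 * ln (sqrt j)\<close>, hence at most \<open>4 * sqrt j\<close>, so a
  convergent series dominates.\<close>

lemma sum_mangoldt_over_squares_le:
  "\<exists>C. \<forall>N. (\<Sum>d\<in>{d\<in>{1..N}. \<exists>j. d = j\<^sup>2}. mangoldt d / real d) \<le> C"
proof -
  have summ: "summable (\<lambda>j. 4 * real j powr (-3/2))"
    by (intro summable_mult) (simp add: summable_real_powr_iff)
  have "(\<Sum>d\<in>{d\<in>{1..N}. \<exists>j. d = j\<^sup>2}. mangoldt d / real d) \<le> (\<Sum>j. 4 * real j powr (-3/2))" for N
  proof -
    have "{d\<in>{1..N}. \<exists>j. d = j\<^sup>2} \<subseteq> power2 ` {1..N}"
    proof
      fix d assume "d \<in> {d\<in>{1..N}. \<exists>j. d = j\<^sup>2}"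
      then obtain j where j: "d = j\<^sup>2" "1 \<le> j\<^sup>2" "j\<^sup>2 \<le> N" by auto
      have "j \<le> j\<^sup>2" by (simp add: power2_nat_le_imp_le)
      moreover have "j \<ge> 1" using j by (cases j) auto
      ultimately show "d \<in> power2 ` {1..N}" using j by auto
    qed
    then have "(\<Sum>d\<in>{d\<in>{1..N}. \<exists>j. d = j\<^sup>2}. mangoldt d / real d) \<le> (\<Sum>d\<in>power2 ` {1..N}. mangoldt d / real d)"
      by (intro sum_mono2) (auto intro!: divide_nonneg_nonneg mangoldt_nonneg)
    also have "\<dots> = (\<Sum>j=1..N. mangoldt (j\<^sup>2) / real (j\<^sup>2))"
      by (subst sum.reindex) (auto simp: inj_on_def)
    also have "\<dots> \<le> (\<Sum>j=1..N. 4 * real j powr (-3/2))"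
    proof (rule sum_mono)
      fix j assume "j \<in> {1..N}"
      then have j: "real j > 0" "j > 0" by auto
      have "mangoldt (j\<^sup>2) \<le> ln (real (j\<^sup>2))" using j by (intro mangoldt_le) auto
      also have "\<dots> = 2 * ln (real j)" using j by (simp add: ln_realpow)
      also have "ln (real j) = 2 * ln (sqrt (real j))" using j by (simp add: ln_sqrt)
      also have "ln (sqrt (real j)) \<le> sqrt (real j)"
        using j ln_le_minus_one[of "sqrt (real j)"] by simp
      finally have "mangoldt (j\<^sup>2) \<le> 4 * sqrt (real j)" by simp
      then have "mangoldt (j\<^sup>2) / real (j\<^sup>2) \<le> 4 * sqrt (real j) / real (j\<^sup>2)"
        by (intro divide_right_mono) auto
      also have "\<dots> = 4 * (real j powr (1/2) / real j powr 2)"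
        using j by (simp add: powr_half_sqrt)
      also have "\<dots> = 4 * real j powr (-3/2)"
        unfolding powr_diff[symmetric] by simp
      finally show "mangoldt (j\<^sup>2) / real (j\<^sup>2) \<le> 4 * real j powr (-3/2)" .
    qed
    also have "\<dots> \<le> (\<Sum>j. 4 * real j powr (-3/2))"
      using summ by (intro sum_le_suminf) auto
    finally show ?thesis .
  qed
  then show ?thesis by blast
qed

section \<open>Orthogonality and Dirichlet's argument\<close>

lemma finite_real_characters:
  "finite {\<psi>. real_character m \<psi>}"
proof (cases "m > 0")
  case True
  let ?S = "{..<m} \<rightarrow>\<^sub>E {-1, 0, 1 :: real}"
  have "{\<psi>. real_character m \<psi>} \<subseteq> (\<lambda>g n. g (n mod m)) ` ?S"
  proof
    fix \<psi> assume "\<psi> \<in> {\<psi>. real_character m \<psi>}"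
    then interpret real_character m \<psi> by simp
    have "\<psi> = (\<lambda>n. restrict \<psi> {..<m} (n mod m))" using True by (auto simp: mod_modulus)
    moreover have "restrict \<psi> {..<m} \<in> ?S" using cases by auto
    ultimately show "\<psi> \<in> (\<lambda>g n. g (n mod m)) ` ?S" by blast
  qed
  then show ?thesis by (rule finite_subset) (auto intro!: finite_PiE)
next
  case False
  then have "\<not> real_character m \<psi>" for \<psi>
    by (auto dest: real_character.modulus_pos)
  then show ?thesis by simp
qed

lemma real_character_mult:
  assumes "real_character m \<psi>" "real_character m \<phi>"
  shows "real_character m (\<lambda>n. \<psi> n * \<phi> n)"
proof -
  interpret A: real_character m \<psi> by fact
  interpret B: real_character m \<phi> by fact
  show ?thesis
  proof
    fix a
    show "\<psi> a * \<phi> a = - 1 \<or> \<psi> a * \<phi> a = 0 \<or> \<psi> a * \<phi> a = 1"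
      using A.cases[of a] B.cases[of a] by auto
  qed (auto simp: A.mult B.mult A.periodic B.periodic A.modulus_pos A.nonzero_iff B.nonzero_iff)
qed

lemma real_character_principal:
  assumes "m > 0"
  shows "real_character m (\<lambda>n. if coprime n m then 1 else 0)"
proof
  show "(if coprime (a + m) m then 1 else 0) = (if coprime a m then 1 else 0 :: real)" for a
    by (simp only: coprime_iff_gcd_eq_1 gcd_add1)
qed (use assms in auto)

text \<open>A character \<open>\<phi>\<close> with \<open>\<phi> a = -1\<close> acts on the real
  characters by multiplication; this is an involution, and it negates the sum.\<close>

lemma sum_real_characters:
  assumes "coprime a m" "m > 0"
  shows "(\<Sum>\<psi> | real_character m \<psi>. \<psi> a)
    = (if \<forall>\<psi>. real_character m \<psi> \<longrightarrow> \<psi> a = 1 then real (card {\<psi>. real_character m \<psi>}) else 0)"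
proof (cases "\<forall>\<psi>. real_character m \<psi> \<longrightarrow> \<psi> a = 1")
  case True
  then have "(\<Sum>\<psi> | real_character m \<psi>. \<psi> a) = (\<Sum>\<psi> | real_character m \<psi>. 1)"
    by (intro sum.cong) auto
  then show ?thesis using True by simp
next
  case False
  then obtain \<phi> where \<phi>: "real_character m \<phi>" "\<phi> a \<noteq> 1" by blast
  interpret real_character m \<phi> by fact
  have "\<phi> a = -1" using cases[of a] nonzero_iff[of a] assms \<phi> by auto
  have inv: "\<phi> n * (\<phi> n * \<psi> n) = \<psi> n" if "real_character m \<psi>" for \<psi> n
  proof -
    interpret P: real_character m \<psi> by fact
    show ?thesis
      using cases[of n] nonzero_iff[of n] P.nonzero_iff[of n] by auto
  qed
  have "(\<Sum>\<psi> | real_character m \<psi>. \<psi> a) = (\<Sum>\<psi> | real_character m \<psi>. \<phi> a * \<psi> a)"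
    by (rule sum.reindex_bij_witness[where i = "\<lambda>\<psi> n. \<phi> n * \<psi> n" and j = "\<lambda>\<psi> n. \<phi> n * \<psi> n"])
       (simp_all add: inv real_character_mult[OF \<phi>(1)])
  also have "\<dots> = - (\<Sum>\<psi> | real_character m \<psi>. \<psi> a)"
    using \<open>\<phi> a = -1\<close> by (simp add: sum_negf)
  finally have "(\<Sum>\<psi> | real_character m \<psi>. \<psi> a) = 0" by simp
  then show ?thesis using False by auto
qed

text \<open>Sum \<open>\<psi> a * G \<psi> N\<close> over all real characters. The principal term is
  at least \<open>ln N\<close> minus a constant and the others are bounded. Exchanging the sums
  leaves only the prime powers \<open>d\<close> with \<open>\<psi> (a * d) = 1\<close> for all
  \<open>\<psi>\<close>; if the desired prime is missing, these are squares and contribute a bounded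
  amount.\<close>

theorem ex_prime_real_characters_eq:
  assumes a: "coprime a m" and m: "m > 0"
  shows "\<exists>r. prime r \<and> coprime r m \<and> (\<forall>\<psi>. real_character m \<psi> \<longrightarrow> \<psi> r = \<psi> a)"
proof (rule ccontr)
  assume no: "\<not> ?thesis"
  define X where "X = {\<psi>. real_character m \<psi>}"
  define \<psi>0 :: "nat \<Rightarrow> real" where "\<psi>0 = (\<lambda>n. if coprime n m then 1 else 0)"
  have X: "finite X" "\<psi>0 \<in> X"
    using finite_real_characters real_character_principal[OF m] by (auto simp: X_def \<psi>0_def)
  define G where "G = (\<lambda>\<psi> N. \<Sum>d=1..N. \<psi> d * mangoldt d / real d)"
  have "\<exists>C. \<forall>N. \<bar>G \<psi> N\<bar> \<le> C" if "\<psi> \<in> X - {\<psi>0}" for \<psi>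
  proof -
    interpret real_character m \<psi> using that by (simp add: X_def)
    have "\<exists>c. \<psi> c = -1"
    proof (rule ccontr)
      assume "\<not> ?thesis"
      then have "\<psi> c = \<psi>0 c" for c
        using cases[of c] nonzero_iff[of c] by (auto simp: \<psi>0_def)
      then show False using that by auto
    qed
    then interpret nonprincipal_real_character m \<psi> by unfold_locales
    show ?thesis using abs_sum_mangoldt_le by (simp add: G_def)
  qed
  then obtain C where C: "\<And>\<psi> N. \<psi> \<in> X - {\<psi>0} \<Longrightarrow> \<bar>G \<psi> N\<bar> \<le> C \<psi>" by metis
  define P where "P = (\<Sum>p\<in>prime_factors m. ln (real p))"
  have G0: "G \<psi>0 N \<ge> ln (real N) - 1 - P" for N
  proof -
    have "(\<Sum>d=1..N. mangoldt d / real d)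
        = (\<Sum>d=1..N. \<psi>0 d * mangoldt d / real d + (if \<not> coprime d m then mangoldt d / real d else 0))"
      by (intro sum.cong) (auto simp: \<psi>0_def)
    also have "\<dots> = G \<psi>0 N + (\<Sum>d\<in>{d\<in>{1..N}. \<not> coprime d m}. mangoldt d / real d)"
      unfolding G_def sum.distrib by (subst sum.inter_filter) auto
    finally show ?thesis
      using sum_mangoldt_over_ge[of N] sum_mangoldt_over_noncoprime_le[OF m, of N]
      unfolding P_def by linarith
  qed
  obtain S where S: "\<And>N. (\<Sum>d\<in>{d\<in>{1..N}. \<exists>j. d = j\<^sup>2}. mangoldt d / real d) \<le> S"
    using sum_mangoldt_over_squares_le by blast
  have up: "(\<Sum>\<psi>\<in>X. \<psi> a * G \<psi> N) \<le> real (card X) * S" for N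
  proof -
    have "(\<Sum>\<psi>\<in>X. \<psi> a * G \<psi> N) = (\<Sum>\<psi>\<in>X. \<Sum>d=1..N. \<psi> (a * d) * (mangoldt d / real d))"
      unfolding G_def sum_distrib_left
      by (intro sum.cong) (auto simp: X_def real_character.mult)
    also have "\<dots> = (\<Sum>d=1..N. (\<Sum>\<psi>\<in>X. \<psi> (a * d)) * (mangoldt d / real d))"
      unfolding sum_distrib_right by (rule sum.swap)
    also have "\<dots> \<le> (\<Sum>d=1..N. if \<exists>j. d = j\<^sup>2 then real (card X) * (mangoldt d / real d) else 0)"
    proof (rule sum_mono)
      fix d assume d: "d \<in> {1..N}"
      have nn: "mangoldt d / real d \<ge> 0" by (intro divide_nonneg_nonneg mangoldt_nonneg) auto
      have "real (card X) * (mangoldt d / real d) \<ge> 0" using nn by (intro mult_nonneg_nonneg) auto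
      then have rhs: "0 \<le> (if \<exists>j. d = j\<^sup>2 then real (card X) * (mangoldt d / real d) else 0)"
        by (cases "\<exists>j. d = j\<^sup>2") (simp_all only: if_True if_False order_refl)
      consider "(\<Sum>\<psi>\<in>X. \<psi> (a * d)) = 0" | "mangoldt d = (0 :: real)"
        | "primepow d" "coprime (a * d) m" "\<And>\<psi>. \<psi> \<in> X \<Longrightarrow> \<psi> (a * d) = 1" "(\<Sum>\<psi>\<in>X. \<psi> (a * d)) = real (card X)"
      proof (cases "primepow d \<and> coprime (a * d) m")
        case False
        then show ?thesis
        proof (cases "primepow d")
          case True
          then have "\<not> coprime (a * d) m" using False by simp
          then have "\<psi> (a * d) = 0" if "\<psi> \<in> X" for \<psi>
            using real_character.nonzero_iff[of m \<psi> "a * d"] that by (auto simp: X_def)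
          then show ?thesis by (intro that(1) sum.neutral) auto
        qed (use that(2) in \<open>simp add: mangoldt_def\<close>)
      next
        case True
        note sum = sum_real_characters[of "a * d" m, folded X_def]
        show ?thesis
        proof (cases "\<forall>\<psi>. real_character m \<psi> \<longrightarrow> \<psi> (a * d) = 1")
          case all: True
          show ?thesis by (rule that(3)) (use True all sum m in \<open>auto simp: X_def\<close>)
        next
          case False
          show ?thesis by (rule that(1)) (use True False sum m in auto)
        qed
      qed
      then show "(\<Sum>\<psi>\<in>X. \<psi> (a * d)) * (mangoldt d / real d)
          \<le> (if \<exists>j. d = j\<^sup>2 then real (card X) * (mangoldt d / real d) else 0)"
      proof cases
        case 3
        obtain q k where qk: "prime q" "k > 0" "d = q ^ k" using 3(1) by (auto simp: primepow_def)
        have cop: "coprime q m" using 3(2) qk by simp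
        \<comment> \<open>An odd power of \<open>q\<close> has the same character values as \<open>q\<close>, so only squares can contribute.\<close>
        have "even k"
        proof (rule ccontr)
          assume "odd k"
          have "\<psi> q = \<psi> a" if "real_character m \<psi>" for \<psi>
          proof -
            interpret real_character m \<psi> by fact
            have "\<psi> a * \<psi> q ^ k = 1" using 3(3)[of \<psi>] that by (simp add: X_def qk mult power)
            then show ?thesis
              using \<open>odd k\<close> cases[of q] cases[of a] qk(2) by (auto simp: power_0_left)
          qed
          then show False using no qk cop by blast
        qed
        then have "d = (q ^ (k div 2))\<^sup>2" using qk by (simp add: power_mult[symmetric])
        then show ?thesis using 3(4) by auto
      qed (use rhs in \<open>simp_all only: mult_zero_left mult_zero_right div_0\<close>)
    qed
    also have "\<dots> = real (card X) * (\<Sum>d\<in>{d\<in>{1..N}. \<exists>j. d = j\<^sup>2}. mangoldt d / real d)"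
      unfolding sum_distrib_left by (subst sum.inter_filter) auto
    also have "\<dots> \<le> real (card X) * S" by (intro mult_left_mono S) auto
    finally show ?thesis .
  qed
  have bound: "ln (real N) \<le> 1 + P + (\<Sum>\<psi>\<in>X - {\<psi>0}. C \<psi>) + real (card X) * S" for N
  proof -
    have "(\<Sum>\<psi>\<in>X. \<psi> a * G \<psi> N) = \<psi>0 a * G \<psi>0 N + (\<Sum>\<psi>\<in>X - {\<psi>0}. \<psi> a * G \<psi> N)"
      using X by (rule sum.remove)
    moreover have "\<psi>0 a = 1" using a by (simp add: \<psi>0_def)
    moreover have "(\<Sum>\<psi>\<in>X - {\<psi>0}. \<psi> a * G \<psi> N) \<ge> (\<Sum>\<psi>\<in>X - {\<psi>0}. - C \<psi>)"
    proof (rule sum_mono)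
      fix \<psi> assume \<psi>: "\<psi> \<in> X - {\<psi>0}"
      then interpret real_character m \<psi> by (simp add: X_def)
      show "- C \<psi> \<le> \<psi> a * G \<psi> N" using cases[of a] C[OF \<psi>, of N] by auto
    qed
    ultimately show ?thesis using G0[of N] up[of N] by (simp add: sum_negf)
  qed
  have "filterlim (\<lambda>N. ln (real N)) at_top sequentially"
    by (rule filterlim_compose[OF ln_at_top filterlim_real_sequentially])
  then have "eventually (\<lambda>N. ln (real N) > 1 + P + (\<Sum>\<psi>\<in>X - {\<psi>0}. C \<psi>) + real (card X) * S) sequentially"
    unfolding filterlim_at_top_dense by (rule spec)
  then obtain N where "ln (real N) > 1 + P + (\<Sum>\<psi>\<in>X - {\<psi>0}. C \<psi>) + real (card X) * S"
    using eventually_happens' sequentially_bot by blast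
  then show False using bound[of N] by linarith
qed

section \<open>The auxiliary prime\<close>

text \<open>Makes quadratic characters of different moduli \<open>k\<close>, perhaps multiplicative
  only on units, into characters of one modulus \<open>m\<close>, so that all of them can be
  controlled by a single prime.\<close>

lemma real_character_lift:
  fixes h :: "nat \<Rightarrow> real"
  assumes "m > 0" "k dvd m"
    and per: "\<And>a. h (a + k) = h a"
    and mult: "\<And>a b. coprime a k \<Longrightarrow> coprime b k \<Longrightarrow> h (a * b) = h a * h b"
    and vals: "\<And>a. coprime a k \<Longrightarrow> h a = 1 \<or> h a = -1"
  shows "real_character m (\<lambda>n. if coprime n m then h n else 0)"
proof -
  obtain j where j: "m = k * j" using assms(2) by (auto elim: dvdE)
  have cop: "coprime a k" if "coprime a m" for a
    using that j by simp
  have "h (a + k * i) = h a" for a i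
  proof (induction i)
    case (Suc i)
    then show ?case using per[of "a + k * i"] by (simp add: algebra_simps)
  qed simp
  then have per': "h (a + m) = h a" for a by (simp add: j)
  show ?thesis
  proof
    fix a b :: nat
    have *: "coprime (a + m) m = coprime a m" by (simp only: coprime_iff_gcd_eq_1 gcd_add1)
    show "(if coprime (a + m) m then h (a + m) else 0) = (if coprime a m then h a else 0)"
      unfolding * per' ..
    show "(if coprime (a * b) m then h (a * b) else 0)
        = (if coprime a m then h a else 0) * (if coprime b m then h b else 0)"
      by (auto simp: mult cop)
    show "(if coprime a m then h a else 0) = - 1 \<or> (if coprime a m then h a else 0) = 0 \<or>
        (if coprime a m then h a else 0) = 1"
      using vals[of a] cop[of a] by auto
    show "((if coprime a m then h a else 0) \<noteq> 0) = coprime a m"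
      using vals[of a] cop[of a] by auto
  qed (use assms in auto)
qed

section \<open>Legendre symbols\<close>

lemma Legendre_values: "Legendre a p = -1 \<or> Legendre a p = 0 \<or> Legendre a p = 1"
  by (auto simp: Legendre_def)

lemma Legendre_eq_0_iff: "Legendre a p = 0 \<longleftrightarrow> p dvd a"
  by (auto simp: Legendre_def cong_0_iff)

lemma Legendre_cong:
  assumes "[a = b] (mod p)"
  shows "Legendre a p = Legendre b p"
proof -
  have "[a = 0] (mod p) \<longleftrightarrow> [b = 0] (mod p)" "QuadRes p a \<longleftrightarrow> QuadRes p b"
    using assms unfolding QuadRes_def cong_def by auto
  then show ?thesis by (simp add: Legendre_def)
qed

text \<open>Two elements of -1, 0, 1 differ by at most 2, so for \<open>p > 2\<close> the congruence
  in Euler's criterion is an equality.\<close>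

lemma Legendre_eqI:
  assumes "prime p" "2 < p" "[a ^ ((p - 1) div 2) = s] (mod int p)" "s = -1 \<or> s = 0 \<or> s = 1"
  shows "Legendre a (int p) = s"
proof -
  have "[Legendre a (int p) = s] (mod int p)"
    using euler_criterion[OF assms(1,2), of a] assms(3) cong_trans by blast
  then have "int p dvd Legendre a (int p) - s" by (simp add: cong_iff_dvd_diff)
  moreover have "\<bar>Legendre a (int p) - s\<bar> \<le> 2"
    using Legendre_values[of a "int p"] assms(4) by auto
  ultimately show ?thesis
    using assms(2) dvd_imp_le_int[of "Legendre a (int p) - s" "int p"] by auto
qed

lemma Legendre_mult:
  assumes "prime p" "2 < p"
  shows "Legendre (a * b) (int p) = Legendre a (int p) * Legendre b (int p)"
proof (rule Legendre_eqI[OF assms])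
  show "[(a * b) ^ ((p - 1) div 2) = Legendre a (int p) * Legendre b (int p)] (mod int p)"
    unfolding power_mult_distrib
    by (intro cong_mult cong_sym[OF euler_criterion[OF assms]])
  show "Legendre a (int p) * Legendre b (int p) = - 1 \<or> Legendre a (int p) * Legendre b (int p) = 0 \<or>
      Legendre a (int p) * Legendre b (int p) = 1"
    using Legendre_values[of a p] Legendre_values[of b p] by auto
qed

lemma Legendre_minus_1:
  assumes "prime p" "2 < p"
  shows "Legendre (-1) (int p) = (-1) ^ ((p - 1) div 2)"
  by (rule Legendre_eqI[OF assms]) (auto simp: minus_one_power_iff)

text \<open>Gauss's lemma with \<open>r = 8 * k + 3\<close>: the doubles \<open>2 * x\<close>
  exceeding \<open>4 * k + 1\<close>, half of \<open>r - 1\<close>, come from \<open>x\<close>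
  between \<open>2 * k + 1\<close> and \<open>4 * k + 1\<close>, and their number
  \<open>2 * k + 1\<close> is odd.\<close>

lemma Legendre_2_mod_8_eq_3:
  assumes "prime r" "r mod 8 = 3"
  shows "Legendre 2 (int r) = -1"
proof -
  define k where "k = int (r div 8)"
  have r: "int r = 8 * k + 3" using assms(2) by (simp add: k_def) presburger
  have k0: "k \<ge> 0" by (simp add: k_def)
  have r2: "2 < r" using r k0 by linarith
  interpret GAUSS r 2
    by unfold_locales (use assms r2 in \<open>auto simp: cong_def\<close>)
  have half: "(int r - 1) div 2 = 4 * k + 1" using r by simp
  have "E = (\<lambda>x. x * 2) ` {2 * k + 1..4 * k + 1}"
  proof -
    have "C = (\<lambda>x. x * 2) ` {0<..4 * k + 1}"
      unfolding C_def B_def A_def half image_image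
      by (intro image_cong) (use r in auto)
    then show ?thesis unfolding E_def half by force
  qed
  moreover have "inj_on (\<lambda>x::int. x * 2) {2 * k + 1..4 * k + 1}" by (auto simp: inj_on_def)
  ultimately have "card E = card {2 * k + 1..4 * k + 1}" by (simp add: card_image)
  also have "\<dots> = 2 * nat k + 1" using k0 by simp
  finally show ?thesis using gauss_lemma by simp
qed

lemma Legendre_2_5: "Legendre 2 5 = -1"
  using Legendre_eqI[of 5 2 "-1"] by (simp add: cong_def)

text \<open>As \<open>r\<close> is 3 modulo 4, reciprocity gives \<open>(p/r)(r/p) = (-1/p)\<close>;
  as 5 is 1 modulo 4, it gives \<open>(p/5) = (5/p)\<close>. Inserting
  \<open>(r/p) = (-1/p)(5/p)\<close> cancels \<open>(-1/p)\<close>.\<close>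

lemma Legendre_eq_via_5:
  fixes p r :: nat
  assumes p: "prime p" "2 < p" "p \<noteq> 5" and r: "prime r" "r mod 8 = 3" "r \<noteq> p"
    and leg: "Legendre (int r) (int p) = Legendre (-5) (int p)"
  shows "Legendre (int p) (int r) = Legendre (int p) 5"
proof -
  have r2: "2 < r" using r(2) prime_ge_2_nat[OF r(1)] by (cases "r = 2") auto
  have "odd ((r - 1) div 2)" using r(2) by presburger
  then have 1: "Legendre (int p) (int r) * Legendre (int r) (int p) = Legendre (-1) (int p)"
    using Quadratic_Reciprocity[of p r] p r r2 by (simp add: Legendre_minus_1 power_mult minus_one_power_iff)
  have 2: "Legendre (int p) 5 * Legendre 5 (int p) = 1"
    using Quadratic_Reciprocity[of p 5] p by (simp add: power_mult minus_one_power_iff)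
  have 3: "Legendre (int r) (int p) = Legendre (-1) (int p) * Legendre 5 (int p)"
    using leg Legendre_mult[OF p(1,2), of "-1" 5] by simp
  have 4: "Legendre (-1) (int p) = 1 \<or> Legendre (-1) (int p) = -1"
    unfolding Legendre_minus_1[OF p(1,2)] by (simp add: minus_one_power_iff)
  have 5: "Legendre 5 (int p) = 1 \<or> Legendre 5 (int p) = -1"
    using 2 Legendre_values[of 5 "int p"] by auto
  from 4 5 show ?thesis using 1 2 unfolding 3 by (elim disjE) simp_all
qed

text \<open>A number \<open>a\<close> that is 3 modulo 8 and -5 modulo \<open>P\<close> has all the
  required symbols. The prime \<open>r\<close> need not be congruent to \<open>a\<close>: it shares
  the values of all real characters modulo \<open>8 * P\<close>, and these determine the
  conditions.\<close>

lemma ex_auxiliary_prime: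
  fixes P :: nat
  assumes P: "odd P" "coprime P 5"
  shows "\<exists>r. prime r \<and> r mod 8 = 3 \<and> coprime r P \<and>
    (\<forall>p. prime p \<longrightarrow> p dvd P \<longrightarrow> Legendre (int r) (int p) = Legendre (-5) (int p))"
proof -
  have P0: "P > 0" using P(1) by (cases P) auto
  define m where "m = 8 * P"
  have m: "m > 0" using P0 by (simp add: m_def)
  have "coprime 8 P"
    using P(1) coprime_power_left_iff[of 2 3 P] by simp
  \<comment> \<open>The residue -5 is written \<open>5 * (P - 1)\<close> to stay within the
    naturals.\<close>
  then obtain a where a: "[a = 3] (mod 8)" "[a = 5 * (P - 1)] (mod P)"
    using binary_chinese_remainder_nat by blast
  have a8: "a mod 8 = 3" using a(1) by (simp add: cong_def)
  have "[int a = int (5 * (P - 1))] (mod int P)" using a(2) unfolding cong_int_iff .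
  moreover have "[int (5 * (P - 1)) = -5] (mod int P)"
    using P0 by (simp add: cong_iff_dvd_diff of_nat_diff algebra_simps)
  ultimately have aP: "[int a = -5] (mod int P)" using cong_trans by blast
  have "coprime (P - 1) P" using coprime_diff_one_left_nat[OF P0] .
  then have "coprime (5 * (P - 1)) P" using P(2) by (simp add: coprime_commute)
  then have "coprime a P" using cong_imp_coprime[OF cong_sym[OF a(2)]] by blast
  moreover have "odd a" using a8 by presburger
  then have "coprime a 8" using coprime_power_right_iff[of a 2 3] by simp
  ultimately have "coprime a m" by (simp add: m_def)
  then obtain r where r: "prime r" "coprime r m" "\<And>\<psi>. real_character m \<psi> \<Longrightarrow> \<psi> r = \<psi> a"
    using ex_prime_real_characters_eq[of a m] m by blast
  have ch: "h r = h a"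
    if "k dvd m" "\<And>a. h (a + k) = h a"
      "\<And>a b. coprime a k \<Longrightarrow> coprime b k \<Longrightarrow> h (a * b) = h a * h b"
      "\<And>a. coprime a k \<Longrightarrow> h a = 1 \<or> h a = -1" for h :: "nat \<Rightarrow> real" and k
    using r(3)[OF real_character_lift[OF m that]] r(2) \<open>coprime a m\<close> by simp
  have "odd r" using r(2) by (auto simp: m_def)
  have "r mod 8 = 3"
  proof -
    have odd4: "n mod 4 = 1 \<or> n mod 4 = 3" if "coprime n 4" for n :: nat
    proof -
      have "odd n" using that coprime_common_divisor[of n 4 2] by auto
      then show ?thesis by presburger
    qed
    have odd8: "n mod 8 = 1 \<or> n mod 8 = 3 \<or> n mod 8 = 5 \<or> n mod 8 = 7" if "coprime n 8" for n :: nat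
    proof -
      have "odd n" using that coprime_common_divisor[of n 8 2] by auto
      then show ?thesis by presburger
    qed
    \<comment> \<open>Among the odd classes modulo 8, only 3 gives -1 for both characters
      \<open>(-1/n)\<close> and \<open>(2/n)\<close>.\<close>
    have "(\<lambda>n::nat. if n mod 4 = 1 then 1 else - 1 :: real) r = (\<lambda>n. if n mod 4 = 1 then 1 else - 1) a"
    proof (rule ch[where k = 4])
      fix x y :: nat assume xy: "coprime x 4" "coprime y 4"
      have eq: "x * y mod 4 = (x mod 4) * (y mod 4) mod 4" by (simp only: mod_mult_eq)
      from odd4[OF xy(1)] odd4[OF xy(2)] show "(if x * y mod 4 = 1 then 1 else - 1 :: real)
          = (if x mod 4 = 1 then 1 else - 1) * (if y mod 4 = 1 then 1 else - 1)"
        unfolding eq by (elim disjE) simp_all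
    qed (auto simp: m_def)
    moreover have "(\<lambda>n::nat. if n mod 8 = 1 \<or> n mod 8 = 7 then 1 else - 1 :: real) r
        = (\<lambda>n. if n mod 8 = 1 \<or> n mod 8 = 7 then 1 else - 1) a"
    proof (rule ch[where k = 8])
      fix x y :: nat assume xy: "coprime x 8" "coprime y 8"
      have eq: "x * y mod 8 = (x mod 8) * (y mod 8) mod 8" by (simp only: mod_mult_eq)
      from odd8[OF xy(1)] odd8[OF xy(2)] show "(if x * y mod 8 = 1 \<or> x * y mod 8 = 7 then 1 else - 1 :: real)
          = (if x mod 8 = 1 \<or> x mod 8 = 7 then 1 else - 1) * (if y mod 8 = 1 \<or> y mod 8 = 7 then 1 else - 1)"
        unfolding eq by (elim disjE) simp_all
    qed (auto simp: m_def)
    moreover have "a mod 4 = 3" using a8 by presburger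
    ultimately have "r mod 4 \<noteq> 1" "r mod 8 \<noteq> 1" "r mod 8 \<noteq> 7"
      using a8 by (auto split: if_splits)
    then show ?thesis using \<open>odd r\<close> by presburger
  qed
  moreover have "Legendre (int r) (int p) = Legendre (-5) (int p)" if p: "prime p" "p dvd P" for p
  proof -
    have "p \<noteq> 2" using p P(1) by auto
    then have p2: "2 < p" using prime_ge_2_nat[OF p(1)] by linarith
    have "real_of_int (Legendre (int r) (int p)) = real_of_int (Legendre (int a) (int p))"
    proof (rule ch[where k = p and h = "\<lambda>n. real_of_int (Legendre (int n) (int p))"])
      show "p dvd m" using p by (simp add: m_def)
      show "real_of_int (Legendre (int (x + p)) (int p)) = real_of_int (Legendre (int x) (int p))" for x
        using Legendre_cong[of "int (x + p)" "int x" "int p"] by (simp add: cong_def)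
      show "real_of_int (Legendre (int (x * y)) (int p))
          = real_of_int (Legendre (int x) (int p)) * real_of_int (Legendre (int y) (int p))" for x y
        using Legendre_mult[OF p(1) p2, of "int x" "int y"] by simp
      show "real_of_int (Legendre (int x) (int p)) = 1 \<or> real_of_int (Legendre (int x) (int p)) = - 1"
        if "coprime x p" for x
      proof -
        have "\<not> p dvd x" using coprime_common_divisor[of x p p] that p(1) by auto
        then show ?thesis using Legendre_values[of "int x" "int p"] Legendre_eq_0_iff[of "int x" "int p"] by auto
      qed
    qed
    then have "Legendre (int r) (int p) = Legendre (int a) (int p)" by simp
    also have "\<dots> = Legendre (-5) (int p)"
      by (intro Legendre_cong cong_dvd_modulus[OF aP]) (use p(2) in simp)
    finally show ?thesis .
  qed
  moreover have "coprime r P" using r(2) by (simp add: m_def)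
  ultimately show ?thesis using r(1) by blast
qed

section \<open>Rational representations by ternary forms\<close>

text \<open>Square roots modulo distinct primes are glued by the Chinese remainder theorem.\<close>

lemma QuadRes_prod:
  assumes "finite S" "\<And>p. p \<in> S \<Longrightarrow> prime p" "\<And>p. p \<in> S \<Longrightarrow> QuadRes (int p) a"
  shows "QuadRes (int (\<Prod>S)) a"
  using assms
proof (induction S rule: finite_induct)
  case empty
  then show ?case by (simp add: QuadRes_def)
next
  case (insert p S)
  obtain y1 where y1: "[y1\<^sup>2 = a] (mod int p)" using insert by (auto simp: QuadRes_def)
  obtain y2 where y2: "[y2\<^sup>2 = a] (mod int (\<Prod>S))" using insert by (auto simp: QuadRes_def)
  have "coprime p (\<Prod>S)"
    using insert by (intro prod_coprime_right) (metis insertI1 insertI2 primes_coprime)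
  then have cop: "coprime (int p) (int (\<Prod>S))" by (simp only: coprime_int_iff)
  obtain y where y: "[y = y1] (mod int p)" "[y = y2] (mod int (\<Prod>S))"
    using binary_chinese_remainder_int[OF cop] by blast
  have "[y\<^sup>2 = a] (mod int p)" "[y\<^sup>2 = a] (mod int (\<Prod>S))"
    using cong_trans[OF cong_pow[OF y(1), of 2] y1] cong_trans[OF cong_pow[OF y(2), of 2] y2] by simp_all
  then have "[y\<^sup>2 = a] (mod int p * int (\<Prod>S))" using cop by (rule coprime_cong_mult)
  then show ?case using insert by (auto simp: QuadRes_def)
qed

lemma QuadRes_2: "QuadRes 2 a"
proof -
  have "[a\<^sup>2 = a] (mod 2)" by (simp add: cong_iff_dvd_diff)
  then show ?thesis by (auto simp: QuadRes_def)
qed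

lemma Legendre_eq_1_imp_QuadRes: "Legendre a p = 1 \<Longrightarrow> QuadRes p a"
  by (auto simp: Legendre_def split: if_splits)

text \<open>Legendre's theorem on \<open>X\<^sup>2 + A W\<^sup>2 = D T\<^sup>2\<close>, by Mordell's pigeonhole argument:
  a short vector in a lattice of index \<open>A D\<close> makes \<open>X\<^sup>2 + A W\<^sup>2 - D T\<^sup>2\<close> equal to \<open>0\<close>
  or \<open>A D\<close>, and multiplicativity of the norm \<open>X\<^sup>2 + A W\<^sup>2\<close> turns the second case into the first.\<close>

lemma legendre_equation_solvable:
  fixes A D :: nat
  assumes pos: "A > 0" "D > 0" and cop: "coprime A D"
    and nsq: "\<And>s. A \<noteq> s\<^sup>2" "\<And>s. D \<noteq> s\<^sup>2"
    and res: "QuadRes (int D) (- int A)" "QuadRes (int A) (int D)"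
  shows "\<exists>X W T. T \<noteq> 0 \<and> X\<^sup>2 + int A * W\<^sup>2 = int D * T\<^sup>2"
proof -
  obtain \<alpha> where \<alpha>: "[\<alpha>\<^sup>2 = - int A] (mod int D)" using res by (auto simp: QuadRes_def)
  obtain \<beta> where \<beta>: "[\<beta>\<^sup>2 = int D] (mod int A)" using res by (auto simp: QuadRes_def)
  define s1 s2 s3 where "s1 = floor_sqrt (A * D)" and "s2 = floor_sqrt D" and "s3 = floor_sqrt A"
  define Box where "Box = {0..s1} \<times> {0..s2} \<times> {0..s3}"
  \<comment> \<open>A collision gives \<open>X\<close> congruent to \<open>\<alpha> * W\<close>
    modulo \<open>D\<close> and to \<open>\<beta> * T\<close> modulo \<open>A\<close>, so
    \<open>F\<close> below is divisible by both moduli.\<close>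
  define f where "f = (\<lambda>(x, w, t). ((int x - \<alpha> * int w) mod int D, (int x - \<beta> * int t) mod int A))"
  \<comment> \<open>The box has more than \<open>A * D\<close> points, since
    \<open>(Suc (floor_sqrt n))\<^sup>2\<close> exceeds \<open>n\<close> for each of the three
    sides.\<close>
  have "(A * D) * D * A < (Suc s1)\<^sup>2 * (Suc s2)\<^sup>2 * (Suc s3)\<^sup>2"
    unfolding s1_def s2_def s3_def
    by (intro mult_strict_mono Suc_floor_sqrt_power2_gt) (use pos in auto)
  then have "(A * D)\<^sup>2 < (Suc s1 * Suc s2 * Suc s3)\<^sup>2"
    by (simp only: power2_eq_square ac_simps)
  then have "A * D < Suc s1 * Suc s2 * Suc s3" by (rule power_less_imp_less_base) simp
  moreover have "card Box = Suc s1 * Suc s2 * Suc s3"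
    by (simp add: Box_def card_cartesian_product algebra_simps)
  moreover have "f ` Box \<subseteq> {0..<int D} \<times> {0..<int A}"
    using pos by (auto simp: f_def)
  then have "card (f ` Box) \<le> card ({0..<int D} \<times> {0..<int A})"
    by (intro card_mono) auto
  then have "card (f ` Box) \<le> A * D"
    by (simp add: card_cartesian_product mult.commute)
  ultimately have "\<not> inj_on f Box" by (intro pigeonhole) linarith
  then obtain b b' where bb: "b \<in> Box" "b' \<in> Box" "f b = f b'" "b \<noteq> b'"
    unfolding inj_on_def by blast
  obtain x w t x' w' t' where b: "b = (x, w, t)" "b' = (x', w', t')" by (metis prod_cases3)
  define X W T where "X = int x - int x'" and "W = int w - int w'" and "T = int t - int t'"
  have nz: "X \<noteq> 0 \<or> W \<noteq> 0 \<or> T \<noteq> 0" using bb(4) b by (auto simp: X_def W_def T_def)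
  have sq: "(int u - int v)\<^sup>2 \<le> int n" if "u \<le> floor_sqrt n" "v \<le> floor_sqrt n" for u v n
  proof -
    have "\<bar>int u - int v\<bar> \<le> int (floor_sqrt n)" using that by auto
    then have "(int u - int v)\<^sup>2 \<le> (int (floor_sqrt n))\<^sup>2"
      by (metis abs_le_square_iff abs_of_nat)
    also have "\<dots> \<le> int n" using floor_sqrt_power2_le[of n] by (metis of_nat_le_iff of_nat_power)
    finally show ?thesis .
  qed
  have X: "X\<^sup>2 \<le> int A * int D" and W: "W\<^sup>2 \<le> int D" and T: "T\<^sup>2 \<le> int A"
    using sq[of x "A * D" x'] sq[of w D w'] sq[of t A t'] bb(1,2)
    by (auto simp: b Box_def X_def W_def T_def s1_def s2_def s3_def)
  have "w\<^sup>2 \<noteq> int n" if "\<And>s. n \<noteq> s\<^sup>2" for w n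
  proof
    assume "w\<^sup>2 = int n"
    then have "int ((nat \<bar>w\<bar>)\<^sup>2) = int n" by simp
    then show False using that[of "nat \<bar>w\<bar>"] by (simp only: of_nat_eq_iff)
  qed
  \<comment> \<open>Nonsquare \<open>A\<close> and \<open>D\<close> make two of the bounds strict,
    which confines \<open>F\<close> strictly between \<open>- A * D\<close> and
    \<open>2 * A * D\<close>.\<close>
  then have "W\<^sup>2 \<noteq> int D" "T\<^sup>2 \<noteq> int A" using nsq by blast+
  then have W': "W\<^sup>2 < int D" and T': "T\<^sup>2 < int A" using W T by auto
  define F where "F = X\<^sup>2 + int A * W\<^sup>2 - int D * T\<^sup>2"
  have "int D dvd F"
  proof -
    have "[int x - \<alpha> * int w = int x' - \<alpha> * int w'] (mod int D)"
      using bb(3) by (simp add: f_def b cong_def)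
    then have "int D dvd X - \<alpha> * W"
      by (simp add: cong_iff_dvd_diff X_def W_def algebra_simps)
    then have "int D dvd (X - \<alpha> * W) * (X + \<alpha> * W)" by simp
    moreover have "int D dvd (\<alpha>\<^sup>2 - (- int A)) * W\<^sup>2" using \<alpha> by (simp add: cong_iff_dvd_diff)
    ultimately have "int D dvd (X - \<alpha> * W) * (X + \<alpha> * W) + (\<alpha>\<^sup>2 - (- int A)) * W\<^sup>2 - int D * T\<^sup>2"
      by (intro dvd_add dvd_diff) auto
    also have "(X - \<alpha> * W) * (X + \<alpha> * W) + (\<alpha>\<^sup>2 - (- int A)) * W\<^sup>2 - int D * T\<^sup>2 = F"
      by (simp add: F_def algebra_simps power2_eq_square)
    finally show ?thesis .
  qed
  moreover have "int A dvd F"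
  proof -
    have "[int x - \<beta> * int t = int x' - \<beta> * int t'] (mod int A)"
      using bb(3) by (simp add: f_def b cong_def)
    then have "int A dvd X - \<beta> * T"
      by (simp add: cong_iff_dvd_diff X_def T_def algebra_simps)
    then have "int A dvd (X - \<beta> * T) * (X + \<beta> * T)" by simp
    moreover have "int A dvd (\<beta>\<^sup>2 - int D) * T\<^sup>2" using \<beta> by (simp add: cong_iff_dvd_diff)
    ultimately have "int A dvd (X - \<beta> * T) * (X + \<beta> * T) + (\<beta>\<^sup>2 - int D) * T\<^sup>2 + int A * W\<^sup>2"
      by (intro dvd_add) auto
    also have "(X - \<beta> * T) * (X + \<beta> * T) + (\<beta>\<^sup>2 - int D) * T\<^sup>2 + int A * W\<^sup>2 = F"
      by (simp add: F_def algebra_simps power2_eq_square)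
    finally show ?thesis .
  qed
  ultimately have "int A * int D dvd F"
    using cop by (intro divides_mult) auto
  then obtain e where e: "F = int A * int D * e" by (auto elim: dvdE)
  have AD: "int A * int D > 0" using pos by simp
  have "int A * W\<^sup>2 < int A * int D" "int D * T\<^sup>2 < int D * int A"
    using W' T' pos by auto
  moreover have nn: "0 \<le> int A * W\<^sup>2" "0 \<le> int D * T\<^sup>2" "0 \<le> X\<^sup>2" by simp_all
  ultimately have "F < 2 * (int A * int D)" "F > - (int A * int D)"
    using X unfolding F_def mult.commute[of "int D" "int A"] by linarith+
  then have "int A * int D * e < int A * int D * 2" "int A * int D * (-1) < int A * int D * e"
    unfolding e by auto
  then have "e < 2" "-1 < e" using AD by (simp_all only: mult_less_cancel_left_pos)
  then consider "e = 0" | "e = 1" by linarith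
  then show ?thesis
  proof cases
    case 1
    then have eq: "X\<^sup>2 + int A * W\<^sup>2 = int D * T\<^sup>2" using e by (simp add: F_def)
    have "T \<noteq> 0"
    proof
      assume "T = 0"
      then have "X\<^sup>2 + int A * W\<^sup>2 = 0" using eq by simp
      then have "X\<^sup>2 = 0" "int A * W\<^sup>2 = 0"
        using nn by linarith+
      then show False using nz pos \<open>T = 0\<close> by auto
    qed
    then show ?thesis using eq by blast
  next
    case 2
    then have eq: "X\<^sup>2 + int A * W\<^sup>2 = int D * (T\<^sup>2 + int A)"
      using e by (simp add: F_def algebra_simps)
    \<comment> \<open>Brahmagupta's identity, multiplying by the norm
      \<open>T\<^sup>2 + A * 1\<^sup>2\<close>, which turns the right side into \<open>D\<close>
      times a square.\<close>
    have "(X * T - int A * W)\<^sup>2 + int A * (X + W * T)\<^sup>2 = (X\<^sup>2 + int A * W\<^sup>2) * (T\<^sup>2 + int A)"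
      by (simp add: algebra_simps power2_eq_square)
    also have "\<dots> = int D * (T\<^sup>2 + int A)\<^sup>2"
      unfolding eq by (simp add: power2_eq_square)
    finally have "(X * T - int A * W)\<^sup>2 + int A * (X + W * T)\<^sup>2 = int D * (T\<^sup>2 + int A)\<^sup>2" .
    moreover have "T\<^sup>2 + int A \<noteq> 0" using pos zero_le_power2[of T] by linarith
    ultimately show ?thesis by blast
  qed
qed

lemma Legendre_prod:
  assumes "prime q" "2 < q" "finite S"
  shows "Legendre (int (\<Prod>S)) (int q) = (\<Prod>p\<in>S. Legendre (int p) (int q))"
  using assms(3)
proof (induction S rule: finite_induct)
  case empty
  show ?case using Legendre_eqI[OF assms(1,2), of 1 1] by simp
qed (simp add: Legendre_mult[OF assms(1,2)])

lemma squarefree_part_eq_prod: "squarefree_part (n :: nat) = \<Prod>(prime_factors (squarefree_part n))"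
proof -
  have "squarefree_part n = (\<Prod>p\<in>prime_factors (squarefree_part n). p ^ multiplicity p (squarefree_part n))"
    by (subst prod_prime_factors) simp_all
  also have "\<dots> = \<Prod>(prime_factors (squarefree_part n))"
  proof (rule prod.cong)
    fix p assume p: "p \<in> prime_factors (squarefree_part n)"
    have "multiplicity p (squarefree_part n) \<le> Suc 0"
      using p by (intro prime_multiplicity_squarefree_part_le_Suc_0) auto
    moreover have "multiplicity p (squarefree_part n) > 0"
      using p by (simp add: prime_factors_multiplicity)
    ultimately have "multiplicity p (squarefree_part n) = 1" by linarith
    then show "p ^ multiplicity p (squarefree_part n) = p" by simp
  qed simp
  finally show ?thesis .
qed

lemma Legendre_5_eq_1:
  assumes "D mod 5 = 1 \<or> D mod 5 = (4 :: nat)"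
  shows "Legendre (int D) 5 = 1"
proof -
  have "[int D = 1] (mod 5) \<or> [int D = 4] (mod 5)"
    using assms of_nat_mod[of D 5, where ?'a = int] by (auto simp: cong_def)
  moreover have "Legendre 1 5 = 1" "Legendre 4 5 = 1"
    using Legendre_eqI[of 5 1 1] Legendre_eqI[of 5 4 1] by (simp_all add: cong_def)
  ultimately show ?thesis using Legendre_cong[of "int D" 1 5] Legendre_cong[of "int D" 4 5] by auto
qed

text \<open>From \<open>X\<^sup>2 + 5 r W\<^sup>2 = D T\<^sup>2\<close> and
  \<open>c\<^sup>2 + 2 d\<^sup>2 = r T1\<^sup>2\<close>, multiplying the first by
  \<open>T1\<^sup>2\<close> and substituting the second turns the middle term into
  \<open>5 (W c)\<^sup>2 + 10 (W d)\<^sup>2\<close>. The square part \<open>k\<close> only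
  scales.\<close>

lemma ternary_rational_representation:
  fixes N :: nat
  assumes N: "N mod 5 = 1 \<or> N mod 5 = 4"
  shows "\<exists>T X Y Z. T \<noteq> 0 \<and> int N * T\<^sup>2 = X\<^sup>2 + 5 * Y\<^sup>2 + 10 * Z\<^sup>2"
proof -
  define D where "D = squarefree_part N"
  define k where "k = square_part N"
  define S where "S = prime_factors D"
  have Nk: "N = D * k\<^sup>2" unfolding D_def k_def by (rule squarefree_decompose)
  have N0: "N > 0" using N by (auto intro: Nat.gr0I)
  have D0: "D > 0" using Nk N0 by (auto intro: Nat.gr0I)
  have DS: "D = \<Prod>S" unfolding D_def S_def by (rule squarefree_part_eq_prod)
  have S: "finite S" "\<And>p. p \<in> S \<Longrightarrow> prime p" "\<And>p. p \<in> S \<Longrightarrow> p dvd D"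
    unfolding S_def by (auto dest: in_prime_factors_imp_prime in_prime_factors_imp_dvd)
  have D5: "D mod 5 = 1 \<or> D mod 5 = 4"
  proof -
    have "(D mod 5) * ((k mod 5) * (k mod 5) mod 5) mod 5 = N mod 5"
      unfolding Nk power2_eq_square by (simp only: mod_mult_left_eq mod_mult_right_eq)
    moreover have "D mod 5 \<in> {0,1,2,3,4}" "k mod 5 \<in> {0,1,2,3,4}" by auto
    ultimately show ?thesis using N by auto
  qed
  have five: "p \<noteq> 5" if "p \<in> S" for p
  proof
    assume "p = 5"
    then have "D mod 5 = 0" using S(3)[OF that] by auto
    then show False using D5 by auto
  qed
  show ?thesis
  proof (cases "\<exists>s. D = s\<^sup>2")
    \<comment> \<open>\<open>legendre_equation_solvable\<close> demands nonsquares, so a square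
      \<open>D\<close> is settled directly.\<close>
    case True
    then obtain s where "D = s\<^sup>2" by blast
    then have "int N * 1\<^sup>2 = (int (s * k))\<^sup>2 + 5 * 0\<^sup>2 + 10 * 0\<^sup>2"
      by (simp add: Nk power_mult_distrib)
    then show ?thesis using one_neq_zero by blast
  next
    case False
    \<comment> \<open>The prime 2 is left out because reciprocity concerns odd primes; at 2, the
      residue of \<open>r\<close> modulo 8 gives \<open>(2/r) = -1 = (2/5)\<close>.\<close>
    define P where "P = \<Prod>(S - {2})"
    have Pdvd: "p \<in> S" if "prime p" "p dvd P" for p
    proof -
      have "\<exists>q\<in>S - {2}. p dvd q"
        using that S(1) prime_dvd_prod_iff[of "S - {2}" p "\<lambda>x. x"] unfolding P_def by simp
      then show ?thesis using S(2) that(1) primes_dvd_imp_eq by blast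
    qed
    have P2: "odd P"
    proof
      assume "2 dvd P"
      have "\<exists>q\<in>S - {2}. 2 dvd q"
        using \<open>2 dvd P\<close> S(1) prime_dvd_prod_iff[of "S - {2}" 2 "\<lambda>x. x"] unfolding P_def by simp
      then obtain q where "q \<in> S" "q \<noteq> 2" "2 dvd q" by blast
      then show False using S(2)[of q] primes_dvd_imp_eq[of 2 q] by simp
    qed
    have "\<not> 5 dvd P" using Pdvd[of 5] five by auto
    then have "coprime P 5" using prime_imp_coprime[of 5 P] by (simp add: coprime_commute)
    then obtain r where r: "prime r" "r mod 8 = 3" "coprime r P"
      and leg: "\<And>p. prime p \<Longrightarrow> p dvd P \<Longrightarrow> Legendre (int r) (int p) = Legendre (-5) (int p)"
      using ex_auxiliary_prime[OF P2] by blast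
    have r2: "2 < r" using r(2) prime_ge_2_nat[OF r(1)] by (cases "r = 2") auto
    have r5: "r \<noteq> 5" using r(2) by auto
    have odd_p: "2 < p" "p dvd P" if "p \<in> S" "p \<noteq> 2" for p
    proof -
      show "2 < p" using prime_ge_2_nat[OF S(2)[OF that(1)]] that(2) by linarith
      show "p dvd P" unfolding P_def by (rule dvd_prodI) (use that S(1) in auto)
    qed
    have rS: "r \<notin> S"
    proof
      assume "r \<in> S"
      then have "r dvd P" using odd_p r2 by auto
      then show False using r(1,3) coprime_common_divisor[of r P r] by auto
    qed
    have key: "Legendre (int p) (int r) = Legendre (int p) 5" if "p \<in> S" for p
    proof (cases "p = 2")
      case True
      then show ?thesis using Legendre_2_mod_8_eq_3[OF r(1,2)] Legendre_2_5 by simp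
    next
      case False
      then show ?thesis
        using Legendre_eq_via_5[of p r] S(2)[OF that] odd_p[OF that] five[OF that] r rS that leg by blast
    qed
    have "Legendre (int D) (int r) = (\<Prod>p\<in>S. Legendre (int p) 5)"
      unfolding DS Legendre_prod[OF r(1) r2 S(1)] by (intro prod.cong) (auto simp: key)
    also have "\<dots> = Legendre (int D) 5"
      unfolding DS using Legendre_prod[of 5 S] S(1) by simp
    also have "\<dots> = 1" using D5 by (rule Legendre_5_eq_1)
    finally have Dr: "Legendre (int D) (int r) = 1" .
    have "QuadRes (int (\<Prod>{5, r})) (int D)"
      using Dr Legendre_5_eq_1[OF D5] r(1)
      by (intro QuadRes_prod) (auto intro: Legendre_eq_1_imp_QuadRes)
    then have res1: "QuadRes (int (5 * r)) (int D)" using r5 by simp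
    have res2: "QuadRes (int D) (- int (5 * r))"
      unfolding DS
    proof (rule QuadRes_prod[OF S(1,2)])
      fix p assume p: "p \<in> S"
      show "QuadRes (int p) (- int (5 * r))"
      proof (cases "p = 2")
        case True
        then show ?thesis using QuadRes_2 by simp
      next
        case False
        note op = odd_p[OF p False]
        \<comment> \<open>By the choice of \<open>r\<close> the symbol \<open>(r/p)\<close> equals
          \<open>(-5/p)\<close>, so the product is a square.\<close>
        have "Legendre (- int (5 * r)) (int p) = Legendre (-5) (int p) * Legendre (-5) (int p)"
          using Legendre_mult[OF S(2)[OF p] op(1), of "-5" "int r"] leg[OF S(2)[OF p] op(2)] by simp
        moreover have "Legendre (-5) (int p) \<noteq> 0"
        proof
          assume "Legendre (-5) (int p) = 0"
          then have "int p dvd -5" by (simp only: Legendre_eq_0_iff)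
          then have "int p dvd int 5" by simp
          then have "p dvd 5" by (simp only: of_nat_dvd_iff)
          then show False using five[OF p] S(2)[OF p] primes_dvd_imp_eq[of p 5] by auto
        qed
        ultimately have "Legendre (- int (5 * r)) (int p) = 1"
          using Legendre_values[of "-5" "int p"] by auto
        then show ?thesis by (rule Legendre_eq_1_imp_QuadRes)
      qed
    qed
    have "coprime (5 * r) D"
    proof -
      have "\<not> 5 dvd D" using D5 by auto
      moreover have "\<not> r dvd D" using rS r(1) D0 by (auto simp: S_def in_prime_factors_iff)
      ultimately show ?thesis using r(1) by (simp add: prime_imp_coprime)
    qed
    moreover have "5 * r \<noteq> s\<^sup>2" for s
    proof
      assume s: "5 * r = s\<^sup>2"
      then have "5 dvd s\<^sup>2" by (metis dvd_triv_left)
      then have "5 dvd s" by (simp add: prime_dvd_power_iff)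
      then obtain u where "s = 5 * u" by (auto elim: dvdE)
      then have "r = 5 * u\<^sup>2" using s by (simp add: power2_eq_square)
      then have "5 dvd r" by simp
      then show False using r(1) r5 primes_dvd_imp_eq[of 5 r] by auto
    qed
    ultimately obtain X W T where XWT: "T \<noteq> 0" "X\<^sup>2 + int (5 * r) * W\<^sup>2 = int D * T\<^sup>2"
      using legendre_equation_solvable[of "5 * r" D] res1 res2 False D0 r2 by auto
    \<comment> \<open>As \<open>r\<close> is 3 modulo 8, both \<open>(-1/r)\<close> and
      \<open>(2/r)\<close> are -1, so -2 is a square modulo \<open>r\<close>, as needed for
      \<open>c\<^sup>2 + 2 d\<^sup>2 = r T1\<^sup>2\<close>.\<close>
    have "Legendre (-2) (int r) = Legendre (-1) (int r) * Legendre 2 (int r)"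
      using Legendre_mult[OF r(1) r2, of "-1" 2] by simp
    moreover have "odd ((r - 1) div 2)" using r(2) by presburger
    ultimately have "Legendre (-2) (int r) = 1"
      using Legendre_2_mod_8_eq_3[OF r(1,2)] Legendre_minus_1[OF r(1) r2] by simp
    then have "QuadRes (int r) (-2)" by (rule Legendre_eq_1_imp_QuadRes)
    moreover have "coprime 2 r" using r(2) by (simp add: coprime_left_2_iff_odd) presburger
    moreover have "2 \<noteq> s\<^sup>2" for s :: nat
    proof (cases "s < 2")
      case True
      then have "s = 0 \<or> s = 1" by auto
      then show ?thesis by auto
    next
      case False
      then show ?thesis using power_mono[of 2 s 2] by simp
    qed
    moreover have "r \<noteq> s\<^sup>2" for s
      using r(1) prime_power_iff[of s 2] by auto
    ultimately obtain c d T1 where cd: "T1 \<noteq> 0" "c\<^sup>2 + 2 * d\<^sup>2 = int r * T1\<^sup>2"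
      using legendre_equation_solvable[of 2 r] QuadRes_2[of "int r"] r2 by auto
    have "int N * (T * T1)\<^sup>2 = (int k * T1)\<^sup>2 * (int D * T\<^sup>2)"
      by (simp add: Nk power_mult_distrib algebra_simps)
    also have "\<dots> = (int k * T1 * X)\<^sup>2 + 5 * ((int r * T1\<^sup>2) * (int k * W)\<^sup>2)"
      unfolding XWT(2)[symmetric] by (simp add: power_mult_distrib algebra_simps)
    also have "\<dots> = (int k * T1 * X)\<^sup>2 + 5 * (int k * W * c)\<^sup>2 + 10 * (int k * W * d)\<^sup>2"
      unfolding cd(2)[symmetric] by (simp add: power_mult_distrib algebra_simps)
    finally have "int N * (T * T1)\<^sup>2
      = (int k * T1 * X)\<^sup>2 + 5 * (int k * W * c)\<^sup>2 + 10 * (int k * W * d)\<^sup>2" .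
    moreover have "T * T1 \<noteq> 0" using XWT(1) cd(1) by simp
    ultimately show ?thesis by blast
  qed
qed

section \<open>The form \<open>2(u\<^sup>2 + v\<^sup>2 + t\<^sup>2) - (uv + ut + vt)\<close> and the Davenport--Cassels descent\<close>

definition tern :: "int \<Rightarrow> int \<Rightarrow> int \<Rightarrow> int" where
  "tern u v t = 2 * (u\<^sup>2 + v\<^sup>2 + t\<^sup>2) - (u * v + u * t + v * t)"

text \<open>Completing the square: this is the link to the diagonal form already represented, and it
  shows definiteness.\<close>

lemma eight_tern: "8 * tern u v t = (4 * u - v - t)\<^sup>2 + 5 * (v + t)\<^sup>2 + 10 * (v - t)\<^sup>2"
  by (simp add: tern_def power2_eq_square algebra_simps)

lemma tern_nonneg: "tern u v t \<ge> 0"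
  using eight_tern[of u v t] zero_le_power2[of "4 * u - v - t"] zero_le_power2[of "v + t"]
    zero_le_power2[of "v - t"] by linarith

lemma tern_eq_0D:
  assumes "tern u v t = 0"
  shows "u = 0 \<and> v = 0 \<and> t = 0"
proof -
  have "(4 * u - v - t)\<^sup>2 = 0" "(v + t)\<^sup>2 = 0" "(v - t)\<^sup>2 = 0"
    using eight_tern[of u v t] assms zero_le_power2[of "4 * u - v - t"] zero_le_power2[of "v + t"]
      zero_le_power2[of "v - t"] by linarith+
  then show ?thesis by simp
qed

text \<open>With barycentric coordinates \<open>l\<^sub>i\<close> in the Delaunay simplex with vertices
  \<open>0\<close>, \<open>e\<^sub>3\<close>, \<open>e\<^sub>2 + e\<^sub>3\<close>, \<open>e\<^sub>1 + e\<^sub>2 + e\<^sub>3\<close>, the mean of the values of the form at the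
  differences to the vertices is \<open>T\<^sup>2\<close> minus a positive definite form of type \<open>A\<^sub>4\<close>.\<close>

lemma tern_near_sorted:
  assumes "0 \<le> u" "u \<le> v" "v \<le> t" "t \<le> T" "T > 0"
  shows "tern u v t < T\<^sup>2 \<or> tern u v (t - T) < T\<^sup>2 \<or> tern u (v - T) (t - T) < T\<^sup>2
    \<or> tern (u - T) (v - T) (t - T) < T\<^sup>2"
proof (rule ccontr)
  assume "\<not> ?thesis"
  then have ge: "T\<^sup>2 \<le> tern u v t" "T\<^sup>2 \<le> tern u v (t - T)" "T\<^sup>2 \<le> tern u (v - T) (t - T)"
    "T\<^sup>2 \<le> tern (u - T) (v - T) (t - T)" by auto
  define l0 l1 l2 l3 where "l0 = T - t" and "l1 = t - v" and "l2 = v - u" and "l3 = u"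
  \<comment> \<open>The form of type \<open>A\<^sub>4\<close> along the chain \<open>l2\<close>,
    \<open>l0\<close>, \<open>l3\<close>, \<open>l1\<close>: squares of consecutive differences,
    with 0 at both ends.\<close>
  define Q where "Q = l2\<^sup>2 + (l2 - l0)\<^sup>2 + (l0 - l3)\<^sup>2 + (l3 - l1)\<^sup>2 + l1\<^sup>2"
  have "l0 * T\<^sup>2 \<le> l0 * tern u v t" "l1 * T\<^sup>2 \<le> l1 * tern u v (t - T)"
    "l2 * T\<^sup>2 \<le> l2 * tern u (v - T) (t - T)" "l3 * T\<^sup>2 \<le> l3 * tern (u - T) (v - T) (t - T)"
    using ge assms by (auto intro!: mult_left_mono simp: l0_def l1_def l2_def l3_def)
  moreover define E where "E = l0 * tern u v t + l1 * tern u v (t - T) + l2 * tern u (v - T) (t - T)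
      + l3 * tern (u - T) (v - T) (t - T)"
  ultimately have "l0 * T\<^sup>2 + l1 * T\<^sup>2 + l2 * T\<^sup>2 + l3 * T\<^sup>2 \<le> E" by linarith
  moreover have "2 * E = 2 * (T * T\<^sup>2) - T * Q"
    unfolding E_def l0_def l1_def l2_def l3_def Q_def tern_def by (simp add: power2_eq_square algebra_simps)
  moreover have "l0 * T\<^sup>2 + l1 * T\<^sup>2 + l2 * T\<^sup>2 + l3 * T\<^sup>2 = T * T\<^sup>2"
    unfolding l0_def l1_def l2_def l3_def by (simp add: algebra_simps)
  ultimately have "T * Q \<le> 0" by linarith
  then have "Q \<le> 0" using assms(5) by (simp add: mult_le_0_iff)
  then have "l2\<^sup>2 = 0" "(l2 - l0)\<^sup>2 = 0" "(l0 - l3)\<^sup>2 = 0" "l1\<^sup>2 = 0"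
    unfolding Q_def
    using zero_le_power2[of l2] zero_le_power2[of "l2 - l0"] zero_le_power2[of "l0 - l3"]
      zero_le_power2[of "l3 - l1"] zero_le_power2[of l1] by linarith+
  then have "l0 = 0" "l1 = 0" "l2 = 0" "l3 = 0" by auto
  then show False using assms(5) by (simp add: l0_def l1_def l2_def l3_def)
qed

text \<open>Reduction modulo \<open>T\<close> moves the point into a cube, and the symmetry of
  \<open>tern\<close> allows its coordinates to be sorted.\<close>

lemma tern_near:
  assumes "T > 0"
  shows "\<exists>a b c. tern (u - T * a) (v - T * b) (t - T * c) < T\<^sup>2"
proof -
  have swap: "tern x y z = tern y x z" "tern x y z = tern x z y" for x y z
    by (simp_all add: tern_def)
  define R where "R = (\<lambda>x y z. \<exists>a b c. tern (x - T * a) (y - T * b) (z - T * c) < T\<^sup>2)"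
  have R12: "R x y z \<Longrightarrow> R y x z" and R23: "R x y z \<Longrightarrow> R x z y" for x y z
    unfolding R_def using swap by metis+
  have sorted: "R x y z" if "0 \<le> x" "x \<le> y" "y \<le> z" "z \<le> T" for x y z
    using tern_near_sorted[OF that assms] unfolding R_def
    by (metis mult_zero_right mult.right_neutral diff_zero)
  define x y z where "x = u mod T" and "y = v mod T" and "z = t mod T"
  have xyz: "0 \<le> x" "x \<le> T" "0 \<le> y" "y \<le> T" "0 \<le> z" "z \<le> T"
    using assms pos_mod_bound[OF assms] by (auto simp: x_def y_def z_def less_imp_le)
  have "x \<le> y \<and> y \<le> z \<or> x \<le> z \<and> z \<le> y \<or> y \<le> x \<and> x \<le> z \<or> y \<le> z \<and> z \<le> x
      \<or> z \<le> x \<and> x \<le> y \<or> z \<le> y \<and> y \<le> x" by linarith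
  then have "R x y z"
    using sorted[of x y z] sorted[of x z y] sorted[of y x z] sorted[of y z x] sorted[of z x y]
      sorted[of z y x] xyz R12 R23 by metis
  then obtain a b c where "tern (x - T * a) (y - T * b) (z - T * c) < T\<^sup>2" by (auto simp: R_def)
  moreover have "x - T * a = u - T * (u div T + a)" "y - T * b = v - T * (v div T + b)"
    "z - T * c = t - T * (t div T + c)"
    by (simp_all add: x_def y_def z_def minus_div_mult_eq_mod[symmetric] algebra_simps)
  ultimately show ?thesis by metis
qed

text \<open>Descent on the denominator: \<open>(a, b, c)\<close> is an integer point near
  \<open>(u, v, t) / T\<close>. Unless the two coincide, the line through them meets the quadric
  \<open>tern = M\<close> in a second rational point with denominator \<open>T'\<close>, where
  \<open>0 < T' < T\<close>.\<close>

lemma tern_davenport_cassels: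
  assumes "T > 0" "M * T\<^sup>2 = tern u v t"
  shows "\<exists>u v t. M = tern u v t"
  using assms
proof (induction "nat T" arbitrary: T u v t rule: less_induct)
  case less
  obtain a b c where near: "tern (u - T * a) (v - T * b) (t - T * c) < T\<^sup>2"
    using tern_near[OF less.prems(1)] by blast
  define p q s where "p = u - T * a" and "q = v - T * b" and "s = t - T * c"
  \<comment> \<open>The polar form of \<open>tern\<close> at \<open>(a, b, c)\<close> and
    \<open>(p, q, s)\<close>, as \<open>expand\<close> shows.\<close>
  define B where "B = 4 * (a * p + b * q + c * s) - (a * q + b * p + a * s + c * p + b * s + c * q)"
  define T' where "T' = M * T - T * tern a b c - B"
  have expand: "tern (x * a + y * p) (x * b + y * q) (x * c + y * s)
      = x\<^sup>2 * tern a b c + x * y * B + y\<^sup>2 * tern p q s" for x y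
    by (simp add: tern_def B_def power2_eq_square algebra_simps)
  have "tern u v t = T\<^sup>2 * tern a b c + T * B + tern p q s"
    using expand[of T 1] by (simp add: p_def q_def s_def)
  then have TT': "tern p q s = T * T'"
    using less.prems(2) by (simp add: T'_def power2_eq_square algebra_simps)
  show ?case
  proof (cases "tern p q s = 0")
    case True
    then have "u = T * a" "v = T * b" "t = T * c" using tern_eq_0D[of p q s] by (auto simp: p_def q_def s_def)
    then have "M * T\<^sup>2 = tern a b c * T\<^sup>2"
      using less.prems(2) by (simp add: tern_def power2_eq_square algebra_simps)
    then show ?thesis using less.prems(1) by auto
  next
    case False
    then have "T * T' > 0" using tern_nonneg[of p q s] TT' by linarith
    then have T'0: "T' > 0" using less.prems(1) by (simp add: zero_less_mult_iff)
    have "T * T' < T * T" using near TT' by (simp add: p_def q_def s_def power2_eq_square)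
    then have "T' < T" using less.prems(1) by simp
    \<comment> \<open>The second intersection point is
      \<open>(a, b, c) + (d / T') (p, q, s)\<close>.\<close>
    define d where "d = tern a b c - M"
    have "tern (T' * a + d * p) (T' * b + d * q) (T' * c + d * s)
        = T'\<^sup>2 * tern a b c + T' * d * B + d\<^sup>2 * (T * T')"
      using expand[of T' d] TT' by simp
    also have "\<dots> = M * T'\<^sup>2 + T' * d * (T' + B + d * T)"
      by (simp add: d_def power2_eq_square algebra_simps)
    also have "T' + B + d * T = 0" by (simp add: T'_def d_def algebra_simps)
    finally have "M * T'\<^sup>2 = tern (T' * a + d * p) (T' * b + d * q) (T' * c + d * s)" by simp
    then show ?thesis using less.hyps[of T'] T'0 \<open>T' < T\<close> by simp
  qed
qed

text \<open>Inverts the substitution of \<open>eight_tern\<close> by \<open>v = Y + Z\<close>,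
  \<open>t = Y - Z\<close>, \<open>u = (X + Y) / 2\<close>; evenness of \<open>N\<close> makes
  \<open>X + Y\<close> even, and the descent removes the denominator.\<close>

lemma tern_represents:
  fixes N :: nat
  assumes "even N" "N mod 5 = 1 \<or> N mod 5 = 4"
  shows "\<exists>u v t. int N = 2 * tern u v t"
proof -
  obtain T X Y Z where T: "T \<noteq> 0" and eq: "int N * T\<^sup>2 = X\<^sup>2 + 5 * Y\<^sup>2 + 10 * Z\<^sup>2"
    using ternary_rational_representation[OF assms(2)] by blast
  obtain M where M: "N = 2 * M" using assms(1) by blast
  have "even (X\<^sup>2 + 5 * Y\<^sup>2 + 10 * Z\<^sup>2)" unfolding eq[symmetric] M by simp
  then have "even (X + Y)" by simp
  then obtain u where u: "X + Y = 2 * u" by blast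
  have "8 * tern u (Y + Z) (Y - Z) = (2 * X)\<^sup>2 + 5 * (2 * Y)\<^sup>2 + 10 * (2 * Z)\<^sup>2"
  proof -
    have "4 * u - (Y + Z) - (Y - Z) = 2 * X" "(Y + Z) + (Y - Z) = 2 * Y" "(Y + Z) - (Y - Z) = 2 * Z"
      using u by auto
    then show ?thesis unfolding eight_tern by (simp only:)
  qed
  also have "\<dots> = 4 * (int N * T\<^sup>2)" unfolding eq by (simp add: power_mult_distrib)
  finally have "int M * \<bar>T\<bar>\<^sup>2 = tern u (Y + Z) (Y - Z)" by (simp add: M)
  then have "\<exists>u v t. int M = tern u v t"
    using T by (intro tern_davenport_cassels[of "\<bar>T\<bar>"]) auto
  then show ?thesis by (auto simp: M)
qed

section \<open>Cauchy's argument\<close>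

lemma two_p5: "2 * p5 k = k * (3 * k - 1)"
  unfolding p5_def by simp

text \<open>Here \<open>b\<close> is prescribed and \<open>2 n = 3 a - b\<close> fixes
  \<open>a\<close>. The bound \<open>low\<close> means \<open>4 a < b\<^sup>2 + 2 b + 5\<close> and
  forces nonnegativity; \<open>high\<close> means \<open>5 a > b\<^sup>2\<close>. Since 5 does not
  divide \<open>b\<close>, the even number \<open>5 a - b\<^sup>2\<close> is 1 or 4 modulo
  5.\<close>

lemma pentagonal_representation_of_sum:
  fixes n b :: int
  assumes b: "b \<ge> 0" "3 dvd n - b" "\<not> 5 dvd b"
    and low: "8 * n < 3 * b\<^sup>2 + 2 * b + 15" and high: "3 * b\<^sup>2 < 10 * n + 5 * b"
  shows "\<exists>x y z w. x \<ge> 0 \<and> y \<ge> 0 \<and> z \<ge> 0 \<and> w \<ge> 0 \<and> n = p5 x + p5 y + p5 z + 2 * p5 w"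
proof -
  have "3 dvd 2 * n + b" using b(2) by presburger
  then obtain a where a: "2 * n + b = 3 * a" by (auto elim: dvdE)
  have low': "4 * a < b\<^sup>2 + 2 * b + 5" using low a by linarith
  define N where "N = 5 * a - b\<^sup>2"
  have N: "N > 0" using high a by (simp add: N_def)
  have "even (a - b)" using a by presburger
  then have "even N" by (simp add: N_def)
  have "b mod 5 = 1 \<or> b mod 5 = 2 \<or> b mod 5 = 3 \<or> b mod 5 = 4" using b(3) by presburger
  then have "(b mod 5) * (b mod 5) mod 5 = 1 \<or> (b mod 5) * (b mod 5) mod 5 = 4" by auto
  then have "b\<^sup>2 mod 5 = 1 \<or> b\<^sup>2 mod 5 = 4" by (simp add: power2_eq_square mod_mult_eq)
  then have "N mod 5 = 1 \<or> N mod 5 = 4" unfolding N_def by presburger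
  moreover obtain N' where N': "N = int N'" using N zero_le_imp_eq_int[of N] by auto
  ultimately have "even N'" "N' mod 5 = 1 \<or> N' mod 5 = 4"
    using \<open>even N\<close> of_nat_mod[of N' 5, where ?'a = int] by auto
  then obtain u v t where uvt: "N = 2 * tern u v t"
    using tern_represents N' by blast
  have tern_minus: "tern (-u) (-v) (-t) = tern u v t" by (simp add: tern_def)
  have dec: "N = 5 * (u\<^sup>2 + v\<^sup>2 + t\<^sup>2) - (u + v + t)\<^sup>2" if "N = 2 * tern u v t" for u v t
    using that by (simp add: tern_def power2_eq_square algebra_simps)
  \<comment> \<open>\<open>b\<close> and \<open>u + v + t\<close> have equal squares modulo 5, so
    they agree up to sign; \<open>tern\<close> is invariant under changing all signs, and this
    yields an integer \<open>w\<close>.\<close>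
  have "5 dvd (b - (u + v + t)) * (b + (u + v + t))"
  proof -
    have "(b - (u + v + t)) * (b + (u + v + t)) = 5 * (a - (u\<^sup>2 + v\<^sup>2 + t\<^sup>2))"
      using dec[OF uvt] by (simp add: N_def power2_eq_square algebra_simps)
    then show ?thesis by simp
  qed
  then have "5 dvd b - (u + v + t) \<or> 5 dvd b + (u + v + t)"
    by (subst (asm) prime_dvd_mult_iff) auto
  then obtain u v t w where uvt: "N = 2 * tern u v t" and w: "b = u + v + t + 5 * w"
  proof
    assume "5 dvd b - (u + v + t)"
    then obtain w where "b - (u + v + t) = 5 * w" by (auto elim: dvdE)
    then show ?thesis using that[of u v t w] uvt by simp
  next
    assume "5 dvd b + (u + v + t)"
    then obtain w where "b + (u + v + t) = 5 * w" by (auto elim: dvdE)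
    then show ?thesis using that[of "-u" "-v" "-t" w] uvt tern_minus by simp
  qed
  define x y z where "x = u + w" and "y = v + w" and "z = t + w"
  have sum1: "x + y + z + 2 * w = b" using w by (simp add: x_def y_def z_def)
  have "5 * (x\<^sup>2 + y\<^sup>2 + z\<^sup>2 + 2 * w\<^sup>2) = N + (u + v + t + 5 * w)\<^sup>2"
    using dec[OF uvt] by (simp add: x_def y_def z_def power2_eq_square algebra_simps)
  then have sum2: "x\<^sup>2 + y\<^sup>2 + z\<^sup>2 + 2 * w\<^sup>2 = a" using w by (simp add: N_def)
  \<comment> \<open>Cauchy-Schwarz for the other variables with weights 1, 1, 2: from
    \<open>x \<le> -1\<close> it would follow that
    \<open>b\<^sup>2 + 2 b + 5 \<le> 4 a\<close>.\<close>
  have cs: "x \<ge> 0" if s1: "x + y + z + 2 * w = b" and s2: "x\<^sup>2 + y\<^sup>2 + z\<^sup>2 + 2 * w\<^sup>2 = a" for x y z w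
  proof (rule ccontr)
    assume "\<not> x \<ge> 0"
    then have x: "x \<le> -1" by simp
    have "(b - x)\<^sup>2 = 4 * (a - x\<^sup>2) - ((y - z)\<^sup>2 + 2 * (y - w)\<^sup>2 + 2 * (z - w)\<^sup>2)"
      unfolding s1[symmetric] s2[symmetric] by (simp add: power2_eq_square algebra_simps)
    moreover have "0 \<le> (y - z)\<^sup>2 + 2 * (y - w)\<^sup>2 + 2 * (z - w)\<^sup>2" by simp
    ultimately have "(b - x)\<^sup>2 \<le> 4 * (a - x\<^sup>2)" by linarith
    then have "b\<^sup>2 + 2 * (b * (- x)) + 5 * x\<^sup>2 \<le> 4 * a" by (simp add: power2_eq_square algebra_simps)
    moreover have "b * 1 \<le> b * (- x)" using b(1) x by (intro mult_left_mono) auto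
    moreover have "1 * 1 \<le> (- x) * (- x)" using x by (intro mult_mono) auto
    ultimately show False using low' by (simp add: power2_eq_square)
  qed
  \<comment> \<open>Likewise with the three variables of weight 1: from \<open>w \<le> -1\<close> it
    would follow that \<open>b\<^sup>2 + 4 b + 10 \<le> 3 a\<close>.\<close>
  have w0: "w \<ge> 0"
  proof (rule ccontr)
    assume "\<not> w \<ge> 0"
    then have w1: "w \<le> -1" by simp
    have "(b - 2 * w)\<^sup>2 = 3 * (a - 2 * w\<^sup>2) - ((x - y)\<^sup>2 + (x - z)\<^sup>2 + (y - z)\<^sup>2)"
      unfolding sum1[symmetric] sum2[symmetric] by (simp add: power2_eq_square algebra_simps)
    moreover have "0 \<le> (x - y)\<^sup>2 + (x - z)\<^sup>2 + (y - z)\<^sup>2" by simp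
    ultimately have "(b - 2 * w)\<^sup>2 \<le> 3 * (a - 2 * w\<^sup>2)" by linarith
    then have "b\<^sup>2 + 4 * (b * (- w)) + 10 * w\<^sup>2 \<le> 3 * a" by (simp add: power2_eq_square algebra_simps)
    moreover have "b * 1 \<le> b * (- w)" using b(1) w1 by (intro mult_left_mono) auto
    moreover have "1 * 1 \<le> (- w) * (- w)" using w1 by (intro mult_mono) auto
    moreover have "a \<ge> 0" using N zero_le_power2[of b] unfolding N_def by linarith
    ultimately show False using low' b(1) by (simp add: power2_eq_square)
  qed
  have x0: "x \<ge> 0" and y0: "y \<ge> 0" and z0: "z \<ge> 0"
    using cs[of x y z w] cs[of y x z w] cs[of z x y w] sum1 sum2 by (simp_all add: algebra_simps)
  have "2 * (p5 x + p5 y + p5 z + 2 * p5 w) = 3 * (x\<^sup>2 + y\<^sup>2 + z\<^sup>2 + 2 * w\<^sup>2) - (x + y + z + 2 * w)"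
    using two_p5[of x] two_p5[of y] two_p5[of z] two_p5[of w]
    by (simp add: power2_eq_square algebra_simps)
  also have "\<dots> = 2 * n" using a by (simp only: sum1 sum2)
  finally have "n = p5 x + p5 y + p5 z + 2 * p5 w" by (simp only: mult_cancel_left) simp
  then show ?thesis using x0 y0 z0 w0 by blast
qed

text \<open>Take \<open>c\<close> minimal for the lower condition on \<open>b\<close>. Some
  \<open>b\<close> from \<open>c\<close> to \<open>c + 5\<close> has the right residue modulo 3 and
  is prime to 5, and by minimality of \<open>c\<close> the upper condition still holds
  there.\<close>

lemma pentagonal_representation_large:
  fixes n :: int
  assumes n: "n \<ge> 612"
  shows "\<exists>x y z w. x \<ge> 0 \<and> y \<ge> 0 \<and> z \<ge> 0 \<and> w \<ge> 0 \<and> n = p5 x + p5 y + p5 z + 2 * p5 w"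
proof -
  define Q where "Q = (\<lambda>k. 8 * n < 3 * (int k)\<^sup>2 + 2 * int k + 15)"
  have "Q (nat (8 * n))"
  proof -
    have eq: "int (nat (8 * n)) = 8 * n" using n by simp
    have "0 \<le> 3 * (8 * n)\<^sup>2" by simp
    then show ?thesis using n unfolding Q_def eq by linarith
  qed
  then have "Q (LEAST k. Q k)" by (rule LeastI)
  then obtain c' where Qc: "Q c'" and least: "\<And>k. k < c' \<Longrightarrow> \<not> Q k"
    using not_less_Least by blast
  define c where "c = int c'"
  \<comment> \<open>At 40 the right side of \<open>Q\<close> is 4895, just below
    \<open>8 * 612 = 4896\<close>; this fixes the threshold 612.\<close>
  have c: "c \<ge> 41"
  proof (rule ccontr)
    assume "\<not> c \<ge> 41"
    then have "c\<^sup>2 \<le> 40\<^sup>2" by (intro power_mono) (auto simp: c_def)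
    then show False using Qc n \<open>\<not> c \<ge> 41\<close> by (simp add: Q_def c_def[symmetric])
  qed
  have low: "8 * n < 3 * c\<^sup>2 + 2 * c + 15" using Qc by (simp add: Q_def c_def)
  have "\<not> Q (c' - 1)" using c by (intro least) (simp add: c_def)
  moreover have "int (c' - 1) = c - 1" using c by (simp add: c_def)
  ultimately have "3 * (c - 1)\<^sup>2 + 2 * (c - 1) + 15 \<le> 8 * n" by (simp add: Q_def)
  then have up: "3 * c\<^sup>2 - 4 * c + 16 \<le> 8 * n" by (simp add: power2_eq_square algebra_simps)
  define b0 where "b0 = c + (n - c) mod 3"
  \<comment> \<open>Adding 3 keeps the residue modulo 3 and leaves the multiples of 5;
    \<open>b0\<close> is at most \<open>c + 2\<close>.\<close>
  define b where "b = (if 5 dvd b0 then b0 + 3 else b0)"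
  have "3 dvd n - b0" unfolding b0_def by presburger
  then have b3: "3 dvd n - b" unfolding b_def by presburger
  have b5: "\<not> 5 dvd b" unfolding b_def by presburger
  have bc: "c \<le> b" "b \<le> c + 5"
    using pos_mod_bound[of 3 "n - c"] pos_mod_sign[of 3 "n - c"] by (auto simp: b_def b0_def)
  have "c\<^sup>2 \<le> b\<^sup>2" using bc c by (intro power_mono) auto
  then have low': "8 * n < 3 * b\<^sup>2 + 2 * b + 15" using low bc by linarith
  \<comment> \<open>The product is the increase of \<open>3 y\<^sup>2 - 5 y\<close> from
    \<open>y = b\<close> to \<open>y = c + 5\<close>. Together with \<open>up\<close>, the upper
    condition reduces to \<open>3 c\<^sup>2 > 120 c + 120\<close>, true from 41 on.\<close>
  have "0 \<le> (c + 5 - b) * (3 * (c + 5 + b) - 5)"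
    using bc c by (intro mult_nonneg_nonneg) auto
  then have "3 * b\<^sup>2 - 5 * b \<le> 3 * c\<^sup>2 + 25 * c + 50" by (simp add: power2_eq_square algebra_simps)
  moreover have "41 * c \<le> c\<^sup>2" using c by (simp add: power2_eq_square)
  ultimately have high: "3 * b\<^sup>2 < 10 * n + 5 * b" using up bc c by linarith
  show ?thesis
    by (rule pentagonal_representation_of_sum[OF _ b3 b5 low' high]) (use bc c in linarith)
qed

section \<open>Finite verification below 612\<close>

text \<open>Position \<open>n\<close>, counted from 0, holds a witness for \<open>n\<close>, so one
  comparison with \<open>[0..611]\<close> checks all cases.\<close>

definition small_witnesses :: "(int \<times> int \<times> int \<times> int) list" where
  "small_witnesses =
    [(0,0,0,0),(1,0,0,0),(1,1,0,0),(1,1,1,0),(1,1,0,1),(2,0,0,0),(2,1,0,0),(2,1,1,0),(2,1,0,1),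
     (2,1,1,1),(2,2,0,0),(2,2,1,0),(3,0,0,0),(3,1,0,0),(3,1,1,0),(3,1,0,1),(3,1,1,1),(3,2,0,0),
     (3,2,1,0),(3,2,0,1),(3,2,1,1),(2,2,1,2),(4,0,0,0),(4,1,0,0),(4,1,1,0),(4,1,0,1),(4,1,1,1),
     (4,2,0,0),(4,2,1,0),(4,2,0,1),(4,2,1,1),(3,3,2,1),(4,2,2,0),(4,1,0,2),(4,3,0,0),(5,0,0,0),
     (5,1,0,0),(5,1,1,0),(5,1,0,1),(5,1,1,1),(5,2,0,0),(5,2,1,0),(5,2,0,1),(5,2,1,1),(4,4,0,0),
     (5,2,2,0),(5,1,0,2),(5,3,0,0),(5,3,1,0),(5,3,0,1),(5,3,1,1),(6,0,0,0),(6,1,0,0),(6,1,1,0),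
     (6,1,0,1),(6,1,1,1),(6,2,0,0),(6,2,1,0),(6,2,0,1),(6,2,1,1),(5,4,1,1),(6,2,2,0),(6,1,0,2),
     (6,3,0,0),(6,3,1,0),(6,3,0,1),(6,3,1,1),(6,2,1,2),(6,3,2,0),(5,4,3,0),(7,0,0,0),(7,1,0,0),
     (7,1,1,0),(7,1,0,1),(7,1,1,1),(7,2,0,0),(7,2,1,0),(7,2,0,1),(7,2,1,1),(5,4,4,0),(7,2,2,0),
     (7,1,0,2),(7,3,0,0),(7,3,1,0),(7,3,0,1),(7,3,1,1),(7,2,1,2),(7,3,2,0),(6,5,0,1),(7,3,2,1),
     (7,2,2,2),(6,5,2,0),(8,0,0,0),(8,1,0,0),(8,1,1,0),(8,1,0,1),(8,1,1,1),(8,2,0,0),(8,2,1,0),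
     (8,2,0,1),(8,2,1,1),(6,5,2,2),(8,2,2,0),(8,1,0,2),(8,3,0,0),(8,3,1,0),(8,3,0,1),(8,3,1,1),
     (8,2,1,2),(8,3,2,0),(7,5,2,0),(8,3,2,1),(8,2,2,2),(6,6,1,2),(8,4,0,0),(8,4,1,0),(8,3,3,0),
     (9,0,0,0),(9,1,0,0),(9,1,1,0),(9,1,0,1),(9,1,1,1),(9,2,0,0),(9,2,1,0),(9,2,0,1),(9,2,1,1),
     (8,4,3,0),(9,2,2,0),(9,1,0,2),(9,3,0,0),(9,3,1,0),(9,3,0,1),(9,3,1,1),(9,2,1,2),(9,3,2,0),
     (7,6,3,1),(9,3,2,1),(9,2,2,2),(8,4,4,1),(9,4,0,0),(9,4,1,0),(9,3,3,0),(9,4,1,1),(9,3,3,1),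
     (9,4,2,0),(8,6,0,1),(9,4,2,1),(9,2,1,3),(8,6,2,0),(9,4,0,2),(9,4,1,2),(9,4,3,0),(9,5,0,0),
     (9,5,1,0),(9,5,0,1),(9,5,1,1),(8,5,2,3),(9,5,2,0),(9,3,2,3),(9,5,2,1),(8,4,4,3),(9,4,4,0),
     (9,5,0,2),(9,4,4,1),(9,5,3,0),(9,3,3,3),(9,5,3,1),(9,5,2,2),(9,6,0,0),(9,6,1,0),(9,6,0,1),
     (9,6,1,1),(8,7,0,2),(9,6,2,0),(9,5,4,0),(9,6,2,1),(9,5,4,1),(9,5,1,3),(9,6,0,2),(9,6,1,2),
     (9,6,3,0),(9,5,2,3),(9,6,3,1),(9,6,2,2),(9,5,4,2),(9,4,4,3),(8,8,0,1),(9,7,0,0),(9,7,1,0),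
     (9,7,0,1),(9,6,4,0),(8,8,2,1),(9,7,2,0),(9,6,1,3),(9,7,2,1),(9,4,3,4),(9,5,0,4),(9,7,0,2),
     (9,7,1,2),(9,7,3,0),(9,6,4,2),(9,7,3,1),(9,7,2,2),(9,6,5,0),(9,6,3,3),(9,6,5,1),(8,8,4,0),
     (8,7,5,2),(9,5,3,4),(9,8,0,0),(9,8,1,0),(9,8,0,1),(9,8,1,1),(9,6,5,2),(9,8,2,0),(8,7,6,1),
     (9,8,2,1),(9,6,2,4),(9,5,4,4),(9,6,6,0),(9,8,1,2),(9,8,3,0),(9,7,5,0),(9,8,3,1),(9,7,5,1),
     (9,2,1,6),(7,6,5,5),(9,6,5,3),(8,8,0,4),(9,6,6,2),(8,8,4,3),(9,8,4,0),(9,7,5,2),(9,8,4,1),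
     (9,9,0,0),(9,9,1,0),(9,9,0,1),(9,9,1,1),(9,7,6,0),(9,9,2,0),(9,7,6,1),(9,9,2,1),(9,4,1,6),
     (9,6,6,3),(9,8,5,0),(9,9,1,2),(9,9,3,0),(9,6,5,4),(9,9,3,1),(9,9,2,2),(9,6,3,5),(8,5,4,6),
     (6,3,2,8),(9,8,0,4),(9,8,5,2),(9,8,4,3),(9,9,4,0),(9,7,7,0),(9,9,4,1),(9,7,7,1),(9,8,6,0),
     (7,7,6,5),(9,8,6,1),(9,9,2,3),(8,8,7,2),(9,8,3,4),(9,9,4,2),(9,7,7,2),(9,8,5,3),(9,9,5,0),
     (9,8,6,2),(9,9,5,1),(8,5,2,7),(9,6,5,5),(9,3,2,7),(9,8,4,4),(9,5,4,6),(8,1,0,8),(9,9,0,4),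
     (9,8,7,0),(9,9,4,3),(9,8,7,1),(9,7,6,4),(9,9,2,4),(9,8,6,3),(9,9,6,0),(8,8,8,2),(9,9,6,1),
     (9,8,5,4),(9,8,7,2),(9,9,3,4),(9,8,3,5),(9,7,5,5),(9,9,5,3),(9,7,2,6),(9,9,6,2),(8,6,6,6),
     (9,5,2,7),(8,8,7,4),(8,7,5,6),(9,9,4,4),(9,8,8,0),(9,1,0,8),(9,8,8,1),(9,9,7,0),(9,9,1,5),
     (9,9,7,1),(9,2,1,8),(9,7,6,5),(9,9,6,3),(8,4,3,8),(9,8,8,2),(9,8,1,6),(9,9,5,4),(9,9,7,2),
     (8,7,6,6),(9,9,3,5),(7,6,3,8),(9,3,2,8),(6,4,3,9),(9,6,3,7),(9,6,6,6),(14,5,0,0),(9,8,7,4),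
     (9,7,5,6),(9,8,8,3),(9,9,8,0),(9,7,7,5),(9,9,8,1),(9,9,6,4),(9,8,6,5),(8,2,0,9),(9,7,2,7),
     (9,8,4,6),(8,7,7,6),(9,4,3,8),(9,9,8,2),(9,9,1,6),(8,3,0,9),(9,9,5,5),(9,7,6,6),(9,9,2,6),
     (6,5,4,9),(9,6,5,7),(7,5,2,9),(9,8,8,4),(9,8,5,6),(8,7,1,8),(9,9,7,4),(9,8,7,5),(9,9,8,3),
     (9,9,9,0),(9,6,0,8),(9,9,9,1),(9,8,2,7),(9,9,6,5),(9,2,0,9),(9,6,2,8),(9,9,4,6),(9,7,7,6),
     (8,4,3,9),(9,9,9,2),(9,8,6,6),(9,3,0,9),(9,6,3,8),(15,5,0,0),(8,5,2,9),(7,6,3,9),(9,3,2,9),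
     (8,8,1,8),(9,9,8,4),(9,8,8,5),(9,7,1,8),(9,4,0,9),(9,9,7,5),(9,9,9,3),(9,7,2,8),(8,6,0,9),
     (9,7,6,7),(9,9,2,7),(8,8,3,8),(9,8,7,6),(8,6,2,9),(9,7,3,8),(9,8,5,7),(9,4,3,9),(9,9,3,7),
     (9,9,6,6),(16,3,0,0),(8,6,3,9),(8,8,4,8),(9,5,2,9),(16,2,1,2),(9,8,0,8),(9,8,1,8),(9,9,9,4),
     (9,9,8,5),(9,7,7,7),(9,8,2,8),(8,6,4,9),(9,8,6,7),(8,7,2,9),(9,6,0,9),(9,8,8,6),(14,9,0,0),
     (9,8,3,8),(9,9,7,6),(9,6,2,9),(9,5,4,9),(9,9,5,7),(16,4,3,0),(16,5,0,0),(8,6,5,9),(16,5,0,1),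
     (9,6,3,9),(9,8,4,8),(8,8,8,7),(16,3,2,3),(9,9,0,8),(9,8,7,7),(16,4,4,0),(9,9,9,5),(9,7,6,8),
     (9,9,2,8),(9,6,4,9),(9,9,6,7),(9,7,2,9),(17,1,1,0),(9,9,8,6),(17,1,1,1),(9,9,3,8),(8,7,5,9),
     (17,2,0,1),(9,7,3,9),(16,6,2,1),(17,2,2,0),(17,1,0,2),(9,6,5,9),(8,8,7,8),(17,3,0,1),
     (9,9,4,8),(9,8,8,7),(17,3,2,0),(9,8,0,9),(9,9,7,7),(17,2,2,2),(16,7,0,0),(8,7,6,9),(9,8,2,9),
     (17,3,3,0),(17,4,1,1),(17,3,3,1),(17,4,2,0),(9,9,9,6),(17,4,2,1),(9,8,3,9),(9,7,5,9),
     (17,4,0,2),(17,4,1,2),(17,4,3,0),(8,8,8,8),(17,5,1,0),(17,5,0,1),(9,8,7,8),(16,6,5,1),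
     (9,8,4,9),(9,9,8,7),(17,5,2,1),(9,9,0,9),(9,9,6,8),(17,5,0,2),(17,4,4,1),(9,7,6,9),(9,9,2,9),
     (17,5,3,1),(17,5,2,2),(17,6,0,0),(18,0,0,0),(9,8,5,9),(18,1,1,0),(9,9,3,9),(18,1,1,1),
     (18,2,0,0),(18,2,1,0),(18,2,0,1),(9,8,8,8),(17,6,0,2),(18,2,2,0),(9,9,7,8),(18,3,0,0),
     (9,9,4,9),(9,9,9,7),(18,3,1,1),(18,2,1,2),(9,8,6,9),(17,7,0,0),(18,3,2,1),(18,2,2,2),
     (17,6,4,0),(18,4,0,0),(18,4,1,0),(18,3,3,0),(18,4,1,1),(9,9,5,9),(18,4,2,0),(17,7,0,2),
     (18,4,2,1),(18,2,1,3),(17,6,4,2),(18,4,0,2),(9,9,8,8),(18,4,3,0),(18,5,0,0),(9,8,7,9),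
     (18,5,0,1),(18,5,1,1),(17,5,3,4),(18,5,2,0),(18,3,2,3),(9,9,6,9),(17,8,1,1),(18,4,4,0),
     (18,5,0,2),(18,4,4,1),(18,5,3,0),(18,3,3,3),(18,5,3,1),(18,5,2,2),(18,6,0,0),(18,6,1,0),
     (18,6,0,1),(18,6,1,1),(19,0,0,0),(19,1,0,0),(19,1,1,0),(9,9,9,8),(19,1,1,1),(19,2,0,0),
     (9,9,7,9),(19,2,0,1),(19,2,1,1),(18,5,2,3),(19,2,2,0),(19,1,0,2),(19,3,0,0),(19,3,1,0),
     (19,3,0,1),(19,3,1,1),(19,2,1,2),(19,3,2,0),(18,6,4,0),(19,3,2,1),(19,2,2,2),(18,6,1,3),
     (19,4,0,0),(19,4,1,0),(19,3,3,0),(19,4,1,1),(19,3,3,1),(19,4,2,0),(9,9,8,9),(19,4,2,1),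
     (19,2,1,3),(18,6,5,0),(19,4,0,2),(19,4,1,2),(19,4,3,0),(19,5,0,0),(19,5,1,0),(19,5,0,1),
     (19,5,1,1),(18,8,0,1),(19,5,2,0),(19,3,2,3),(19,5,2,1),(17,7,7,2),(19,4,4,0),(19,5,0,2),
     (19,4,4,1),(19,5,3,0),(19,3,3,3),(19,5,3,1),(19,5,2,2),(19,6,0,0),(19,6,1,0),(9,9,9,9),
     (19,6,1,1),(18,6,5,3),(19,6,2,0),(19,5,4,0),(20,0,0,0),(20,1,0,0),(20,1,1,0),(20,1,0,1),
     (20,1,1,1),(20,2,0,0),(20,2,1,0),(20,2,0,1),(20,2,1,1),(19,5,4,2),(20,2,2,0),(20,1,0,2),
     (20,3,0,0),(20,3,1,0),(20,3,0,1),(20,3,1,1),(20,2,1,2),(20,3,2,0),(19,6,1,3),(20,3,2,1),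
     (20,2,2,2),(19,5,0,4)]"

lemma map_small_witnesses:
  "map (\<lambda>(x, y, z, w). p5 x + p5 y + p5 z + 2 * p5 w) small_witnesses = [0..611]"
  by code_simp

lemma small_witnesses_nonneg:
  "list_all (\<lambda>(x, y, z, w). 0 \<le> x \<and> 0 \<le> y \<and> 0 \<le> z \<and> 0 \<le> w) small_witnesses"
  by code_simp

lemma pentagonal_representation_small:
  fixes n :: int
  assumes "0 \<le> n" "n < 612"
  shows "\<exists>x y z w. x \<ge> 0 \<and> y \<ge> 0 \<and> z \<ge> 0 \<and> w \<ge> 0 \<and> n = p5 x + p5 y + p5 z + 2 * p5 w"
proof -
  have "n \<in> set [0..611]" using assms by simp
  then have "n \<in> (\<lambda>(x, y, z, w). p5 x + p5 y + p5 z + 2 * p5 w) ` set small_witnesses"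
    unfolding map_small_witnesses[symmetric] set_map .
  then obtain x y z w where "(x, y, z, w) \<in> set small_witnesses" "n = p5 x + p5 y + p5 z + 2 * p5 w"
    by auto
  moreover have "0 \<le> x \<and> 0 \<le> y \<and> 0 \<le> z \<and> 0 \<le> w"
    using small_witnesses_nonneg calculation(1) by (auto simp: list_all_iff)
  ultimately show ?thesis by blast
qed

theorem theorem1p1:
  fixes n :: int
  assumes "n \<ge> 0"
  shows "\<exists>x y z w. x \<ge> 0 \<and> y \<ge> 0 \<and> z \<ge> 0 \<and> w \<ge> 0 \<and>
           n = p5 x + p5 y + p5 z + 2 * p5 w"
proof (cases "n < 612")
  case True
  show ?thesis by (rule pentagonal_representation_small[OF assms True])
next
  case False
  then show ?thesis by (intro pentagonal_representation_large) simp
qed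

end
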